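(* Let $\theta_0,\varphi_0\in(0,\pi)$ and suppose $\theta(e)=\theta_0$ and $\varphi(e)=\varphi_0$ for all $e\in E(\Gamma)$. Let $0<\alpha<\pi/\theta_0$. Then there exists a non-trivial balanced homogeneous harmonic map $f:C(\Gamma,\theta)\to C(\Gamma,\varphi)$ of degree $\alpha$ if and only if $\alpha\theta_0=\varphi_0$. Moreover, if $\alpha\theta_0=\varphi_0=\pi/2$, then for every function $\rho:V(\Gamma)\to[0,\infty)$ the homogeneous harmonic map of degree $\alpha$ determined by $\rho$ is balanced; while if $\alpha\theta_0=\varphi_0\ne\pi/2$, then the homogeneous harmonic map of degree $\alpha$ determined by $\rho:V(\Gamma)\to[0,\infty)$ is balanced if and only if $\rho$ is constant.
   Context: $\Gamma$ is a finite connected simplicial graph (no loops or multiple edges) with at least one edge, vertex set $V(\Gamma)$, edge set $E(\Gamma)$. $\theta,\varphi:E(\Gamma)\to(0,\pi)$ are functions. $S_{\theta_0}=\{(r,\theta): r\ge 0,\ 0\le\theta\le\theta_0\}\subset\mathbb{R}^2$ is the plane sector in polar coordinates. The cone $C(\Gamma)=(\Gamma\times[0,\infty))/\!\sim$ collapses $\Gamma\times\{0\}$ to a point (its vertex). $C(\Gamma,\theta)$ is $C(\Gamma)$ with the metric for which each face $C(e)$ is isometric to $S_{\theta(e)}$: identifying $e$ with $[0,1]$, $(x,t)\in C(e)$ corresponds to polar coordinates $(t,x\theta(e))$; similarly for $C(\Gamma,\varphi)$. If $v$ is an endpoint of $e$, coordinates adapted to $v$ are those where $v$ corresponds to $0$,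 so $C(v)=\{v\}\times[0,\infty)$ is the positive $x$-axis. A homogeneous map $f:C(\Gamma,\theta)\to C(\Gamma,\varphi)$ of degree $\alpha>0$ is a continuous map of the form $f(x,t)=(y(x),s(x)t^\alpha)$ with $y:\Gamma\to\Gamma$, $s:\Gamma\to[0,\infty)$. All such maps considered send each edge $C(v)$ into itself and each face $C(e)$ into itself. The map is trivial if it sends everything to the vertex. It is harmonic if, for each face, its coordinate representation $S_{\theta(e)}\to S_{\varphi(e)}\subset\mathbb{R}^2$ has both rectangular components harmonic in the interior of the sector. It is balanced if for every $v\in V(\Gamma)$, $\sum_j\frac{\partial x_j}{\partial\theta}(r,0)=0$ for all $r>0$, where $e_j$ runs over edges incident to $v$ and $u_j=(x_j,y_j):S_{\theta(e_j)}\to S_{\varphi(e_j)}$ represents $f|_{C(e_j)}$ in coordinates adapted to $v$ in both domain (polar $(r,\theta)$) and target (rectangular). For $0<\alpha<\pi/\max_e\theta(e)$, each $\rho:V(\Gamma)\to[0,\infty)$ determines a unique homogeneous harmonic map $f$ of degree $\alpha$ with $f(v,1)=(v,\rho(v))$ for all $v\in V(\Gamma)$; this is the map determined by $\rho$. *)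

theory Defs
  imports "HOL-Analysis.Analysis"
begin

section \<open>Graphs\<close>

text \<open>A simplicial graph is given by its vertex set and a set of two-element subsets of it; the
  absence of loops and multiple edges is built into this encoding.\<close>

definition finite_connected_graph :: "'v set \<Rightarrow> 'v set set \<Rightarrow> bool" where
  "finite_connected_graph V E \<longleftrightarrow>
     finite V \<and>
     (\<forall>e\<in>E. e \<subseteq> V \<and> card e = 2) \<and>
     (\<forall>u\<in>V. \<forall>v\<in>V. (u, v) \<in> {(a, b). {a, b} \<in> E}\<^sup>*)"

section \<open>Realization and cone\<close>

text \<open>Points of the realization are given by barycentric coordinates \<open>'v \<Rightarrow> real\<close>, with the
  product topology. For \<open>e = {v, w}\<close>, \<open>edge_point v w\<close> identifies \<open>[0, 1]\<close> with \<open>e\<close>, sending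
  0 to \<open>v\<close> and 1 to \<open>w\<close>.\<close>

definition std_simplex :: "'v set \<Rightarrow> ('v \<Rightarrow> real) set" where
  "std_simplex \<sigma> = {x. (\<forall>u. 0 \<le> x u) \<and> (\<forall>u. u \<notin> \<sigma> \<longrightarrow> x u = 0) \<and> (\<Sum>u\<in>\<sigma>. x u) = 1}"

definition realization :: "'v set \<Rightarrow> 'v set set \<Rightarrow> ('v \<Rightarrow> real) set" where
  "realization V E = (\<Union>v\<in>V. std_simplex {v}) \<union> (\<Union>e\<in>E. std_simplex e)"

definition vertex_point :: "'v \<Rightarrow> 'v \<Rightarrow> real" where
  "vertex_point v = (\<lambda>u. if u = v then 1 else 0)"

definition edge_point :: "'v \<Rightarrow> 'v \<Rightarrow> real \<Rightarrow> 'v \<Rightarrow> real" where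
  "edge_point v w s = (\<lambda>u. (1 - s) * vertex_point v u + s * vertex_point w u)"

text \<open>The point \<open>(x, t)\<close> of the cone is represented by the scaled coordinates \<open>t * x\<close>. This
  identifies exactly the points with \<open>t = 0\<close> (lemma \<open>cone_point_eq_iff\<close>). The topology so obtained
  is the one of the metric in which the faces are isometric to sectors: the charts \<open>face_chart\<close>
  below are homeomorphisms (lemma \<open>homeomorphism_face_chart\<close>), and continuity can be tested on
  faces (lemma \<open>continuous_on_graph_cone_iff\<close>).\<close>

definition cone_point :: "('v \<Rightarrow> real) \<Rightarrow> real \<Rightarrow> 'v \<Rightarrow> real" where
  "cone_point x t = (\<lambda>u. t * x u)"

definition cone_over :: "('v \<Rightarrow> real) set \<Rightarrow> ('v \<Rightarrow> real) set" where
  "cone_over A = {cone_point x t | x t. x \<in> A \<and> 0 \<le> t}"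

definition graph_cone :: "'v set \<Rightarrow> 'v set set \<Rightarrow> ('v \<Rightarrow> real) set" where
  "graph_cone V E = cone_over (realization V E)"

definition apex :: "'v \<Rightarrow> real" where
  "apex = (\<lambda>_. 0)"

section \<open>Sectors and face coordinates\<close>

text \<open>The Euclidean plane is the type \<^typ>\<open>complex\<close>; the rectangular coordinates are \<^const>\<open>Re\<close>
  and \<^const>\<open>Im\<close>.\<close>

definition sector :: "real \<Rightarrow> complex set" where
  "sector a = {rcis r \<eta> | r \<eta>. 0 \<le> r \<and> 0 \<le> \<eta> \<and> \<eta> \<le> a}"

text \<open>For \<open>0 < a < pi\<close> the chart below sends the point with polar coordinates \<open>(t, x * a)\<close>,
  \<open>0 \<le> x \<le> 1\<close>, to the point \<open>(x, t)\<close> of the face over \<open>{v, w}\<close>, in coordinates adapted to \<open>v\<close>.\<close>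

definition face_chart :: "real \<Rightarrow> 'v \<Rightarrow> 'v \<Rightarrow> complex \<Rightarrow> 'v \<Rightarrow> real" where
  "face_chart a v w z = cone_point (edge_point v w (Arg z / a)) (cmod z)"

definition coord_rep ::
  "('v set \<Rightarrow> real) \<Rightarrow> ('v set \<Rightarrow> real) \<Rightarrow> (('v \<Rightarrow> real) \<Rightarrow> ('v \<Rightarrow> real)) \<Rightarrow> 'v \<Rightarrow> 'v \<Rightarrow> complex \<Rightarrow> complex"
  where
  "coord_rep \<theta> \<phi> f v w z =
     inv_into (sector (\<phi> {v, w})) (face_chart (\<phi> {v, w}) v w) (f (face_chart (\<theta> {v, w}) v w z))"

section \<open>Homogeneous, harmonic and balanced maps\<close>

definition homogeneous_map ::
  "'v set \<Rightarrow> 'v set set \<Rightarrow> real \<Rightarrow> (('v \<Rightarrow> real) \<Rightarrow> ('v \<Rightarrow> real)) \<Rightarrow> bool" where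
  "homogeneous_map V E \<alpha> f \<longleftrightarrow>
     0 < \<alpha> \<and>
     continuous_on (graph_cone V E) f \<and>
     f ` graph_cone V E \<subseteq> graph_cone V E \<and>
     (\<exists>y s. (\<forall>x\<in>realization V E. y x \<in> realization V E \<and> 0 \<le> s x) \<and>
            (\<forall>x\<in>realization V E. \<forall>t\<ge>0.
               f (cone_point x t) = cone_point (y x) (s x * t powr \<alpha>))) \<and>
     (\<forall>v\<in>V. f ` cone_over (std_simplex {v}) \<subseteq> cone_over (std_simplex {v})) \<and>
     (\<forall>e\<in>E. f ` cone_over (std_simplex e) \<subseteq> cone_over (std_simplex e))"

definition trivial_map ::
  "'v set \<Rightarrow> 'v set set \<Rightarrow> (('v \<Rightarrow> real) \<Rightarrow> ('v \<Rightarrow> real)) \<Rightarrow> bool" where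
  "trivial_map V E f \<longleftrightarrow> (\<forall>p\<in>graph_cone V E. f p = apex)"

text \<open>\<open>D z\<close> is the gradient and \<open>H z\<close> the Hessian of the twice continuously differentiable
  function \<open>u\<close>; the Laplacian is the trace of the Hessian. The set \<open>S\<close> is meant to be open.\<close>

definition harmonic_fun_on :: "('a::euclidean_space \<Rightarrow> real) \<Rightarrow> 'a set \<Rightarrow> bool" where
  "harmonic_fun_on u S \<longleftrightarrow>
     (\<exists>D H. (\<forall>z\<in>S. (u has_derivative (\<lambda>h. D z \<bullet> h)) (at z)) \<and>
            (\<forall>z\<in>S. (D has_derivative H z) (at z)) \<and>
            (\<forall>h. continuous_on S (\<lambda>z. H z h)) \<and>
            (\<forall>z\<in>S. (\<Sum>b\<in>Basis. H z b \<bullet> b) = 0))"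

definition harmonic_map ::
  "'v set set \<Rightarrow> ('v set \<Rightarrow> real) \<Rightarrow> ('v set \<Rightarrow> real) \<Rightarrow> (('v \<Rightarrow> real) \<Rightarrow> ('v \<Rightarrow> real)) \<Rightarrow> bool" where
  "harmonic_map E \<theta> \<phi> f \<longleftrightarrow>
     (\<forall>v w. {v, w} \<in> E \<longrightarrow>
        harmonic_fun_on (\<lambda>z. Re (coord_rep \<theta> \<phi> f v w z)) (interior (sector (\<theta> {v, w}))) \<and>
        harmonic_fun_on (\<lambda>z. Im (coord_rep \<theta> \<phi> f v w z)) (interior (sector (\<theta> {v, w}))))"

definition homogeneous_harmonic_map ::
  "'v set \<Rightarrow> 'v set set \<Rightarrow> ('v set \<Rightarrow> real) \<Rightarrow> ('v set \<Rightarrow> real) \<Rightarrow> real \<Rightarrow>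
   (('v \<Rightarrow> real) \<Rightarrow> ('v \<Rightarrow> real)) \<Rightarrow> bool" where
  "homogeneous_harmonic_map V E \<theta> \<phi> \<alpha> f \<longleftrightarrow> homogeneous_map V E \<alpha> f \<and> harmonic_map E \<theta> \<phi> f"

text \<open>The edges incident to \<open>v\<close> are indexed by their other endpoints \<open>w\<close>. The derivative in the
  polar angle at 0 is one-sided, since the sector lies on one side of the positive real axis.\<close>

definition balanced_map ::
  "'v set \<Rightarrow> 'v set set \<Rightarrow> ('v set \<Rightarrow> real) \<Rightarrow> ('v set \<Rightarrow> real) \<Rightarrow>
   (('v \<Rightarrow> real) \<Rightarrow> ('v \<Rightarrow> real)) \<Rightarrow> bool" where
  "balanced_map V E \<theta> \<phi> f \<longleftrightarrow>
     (\<forall>v\<in>V. \<forall>r>0. \<exists>d.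
        (\<forall>w. {v, w} \<in> E \<longrightarrow>
           ((\<lambda>\<eta>. Re (coord_rep \<theta> \<phi> f v w (rcis r \<eta>))) has_real_derivative d w)
             (at 0 within {0..\<theta> {v, w}})) \<and>
        (\<Sum>w | {v, w} \<in> E. d w) = 0)"

text \<open>For \<open>0 < \<alpha> < pi / Max (\<theta> ` E)\<close> and \<open>\<rho> \<ge> 0\<close> on \<open>V\<close> there is exactly one such map on the cone;
  \<^const>\<open>extensional\<close> fixes its irrelevant values outside the cone, so that the description is
  also unique as a function on the whole type.\<close>

definition determined_map ::
  "'v set \<Rightarrow> 'v set set \<Rightarrow> ('v set \<Rightarrow> real) \<Rightarrow> ('v set \<Rightarrow> real) \<Rightarrow> real \<Rightarrow> ('v \<Rightarrow> real) \<Rightarrow>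
   (('v \<Rightarrow> real) \<Rightarrow> ('v \<Rightarrow> real))" where
  "determined_map V E \<theta> \<phi> \<alpha> \<rho> =
     (THE f. f \<in> extensional (graph_cone V E) \<and>
             homogeneous_harmonic_map V E \<theta> \<phi> \<alpha> f \<and>
             (\<forall>v\<in>V. f (cone_point (vertex_point v) 1) = cone_point (vertex_point v) (\<rho> v)))"

section \<open>The topology of the cone\<close>

lemma realization_sum:
  assumes "finite_connected_graph V E" "x \<in> realization V E"
  shows "(\<Sum>u\<in>V. x u) = 1"
proof -
  have fV: "finite V" using assms by (simp add: finite_connected_graph_def)
  obtain \<sigma> where s: "\<sigma> \<subseteq> V" "x \<in> std_simplex \<sigma>"
    using assms unfolding realization_def finite_connected_graph_def by auto
  have "(\<Sum>u\<in>V. x u) = (\<Sum>u\<in>\<sigma>. x u)"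
    using s fV by (intro sum.mono_neutral_right) (auto simp: std_simplex_def)
  with s show ?thesis by (simp add: std_simplex_def)
qed

lemma cone_point_eq_iff:
  assumes G: "finite_connected_graph V E"
    and x: "x \<in> realization V E" and y: "y \<in> realization V E" and "0 \<le> s" "0 \<le> t"
  shows "cone_point x s = cone_point y t \<longleftrightarrow> (s = 0 \<and> t = 0) \<or> (x = y \<and> s = t)"
proof
  assume eq: "cone_point x s = cone_point y t"
  have "s = (\<Sum>u\<in>V. cone_point x s u)"
    by (simp add: cone_point_def realization_sum[OF G x] flip: sum_distrib_left)
  also have "\<dots> = t"
    by (simp add: eq) (simp add: cone_point_def realization_sum[OF G y] flip: sum_distrib_left)
  finally have st: "s = t" .
  show "(s = 0 \<and> t = 0) \<or> (x = y \<and> s = t)"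
    using eq st by (auto simp: cone_point_def fun_eq_iff)
qed (auto simp: cone_point_def)

lemma cone_over_std_simplex:
  assumes "finite \<sigma>" "\<sigma> \<noteq> {}"
  shows "cone_over (std_simplex \<sigma>) = {p. (\<forall>u. 0 \<le> p u) \<and> (\<forall>u. u \<notin> \<sigma> \<longrightarrow> p u = 0)}"
proof (intro equalityI subsetI)
  fix p assume "p \<in> {p. (\<forall>u. 0 \<le> p u) \<and> (\<forall>u. u \<notin> \<sigma> \<longrightarrow> p u = (0::real))}"
  then have p: "\<And>u. 0 \<le> p u" "\<And>u. u \<notin> \<sigma> \<Longrightarrow> p u = 0" by auto
  define t where "t = (\<Sum>u\<in>\<sigma>. p u)"
  obtain a where a: "a \<in> \<sigma>" using assms by auto
  show "p \<in> cone_over (std_simplex \<sigma>)"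
  proof (cases "t = 0")
    case True
    then have "\<forall>u\<in>\<sigma>. p u = 0"
      unfolding t_def using p assms(1) by (subst (asm) sum_nonneg_eq_0_iff) auto
    then have "p = cone_point (vertex_point a) 0"
      using p by (auto simp: cone_point_def fun_eq_iff)
    moreover have "vertex_point a \<in> std_simplex \<sigma>"
      using a assms(1) by (auto simp: std_simplex_def vertex_point_def)
    ultimately show ?thesis unfolding cone_over_def by blast
  next
    case False
    have t: "0 < t" using False p unfolding t_def by (simp add: less_le sum_nonneg)
    have "p = cone_point (\<lambda>u. p u / t) t" using t by (simp add: cone_point_def)
    moreover have "(\<lambda>u. p u / t) \<in> std_simplex \<sigma>"
      using p t by (auto simp: std_simplex_def t_def simp flip: sum_divide_distrib)
    ultimately show ?thesis unfolding cone_over_def using t less_imp_le by blast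
  qed
qed (auto simp: cone_over_def cone_point_def std_simplex_def)

lemma sector_props:
  assumes "0 < a" "a < pi" "z \<in> sector a"
  shows "0 \<le> Arg z" "Arg z \<le> a"
proof -
  obtain r \<eta> where z: "z = rcis r \<eta>" "0 \<le> r" "0 \<le> \<eta>" "\<eta> \<le> a"
    using assms(3) by (auto simp: sector_def)
  have "Arg z = 0 \<or> Arg z = \<eta>"
    using z assms(1,2) by (cases "r = 0") (auto simp: Arg_rcis Arg_zero)
  then show "0 \<le> Arg z" "Arg z \<le> a" using z assms by auto
qed

lemma continuous_within_null_comparison:
  fixes h :: "'a::t2_space \<Rightarrow> 'b::real_normed_vector" and k :: "'a \<Rightarrow> 'c::real_normed_vector"
  assumes "h x = 0" "\<forall>y\<in>S. norm (h y) \<le> norm (k y)" "k x = 0" "continuous (at x within S) k"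
  shows "continuous (at x within S) h"
proof -
  have "(k \<longlongrightarrow> 0) (at x within S)" using assms by (simp add: continuous_within)
  then have "((\<lambda>y. norm (k y)) \<longlongrightarrow> 0) (at x within S)" by (rule tendsto_norm_zero)
  moreover have "\<forall>\<^sub>F y in at x within S. norm (h y) \<le> norm (k y)"
    using assms(2) by (auto simp: eventually_at_topological)
  ultimately have "(h \<longlongrightarrow> 0) (at x within S)"
    by (rule Lim_null_comparison[rotated])
  then show ?thesis using assms by (simp add: continuous_within)
qed

lemma homeomorphism_face_chart:
  assumes a: "0 < a" "a < pi" and "v \<noteq> w"
  shows "homeomorphism (sector a) (cone_over (std_simplex {v, w})) (face_chart a v w)
           (\<lambda>p. rcis (p v + p w) (a * (p w / (p v + p w))))"
proof -
  let ?g = "\<lambda>p. rcis (p v + p w) (a * (p w / (p v + p w)))"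
  let ?C = "cone_over (std_simplex {v, w})"
  have C: "?C = {p. (\<forall>u. 0 \<le> p u) \<and> (\<forall>u. u \<notin> {v, w} \<longrightarrow> p u = 0)}"
    by (rule cone_over_std_simplex) auto
  have fc: "face_chart a v w z =
      (\<lambda>u. if u = v then cmod z * (1 - Arg z / a) else if u = w then cmod z * (Arg z / a) else 0)" for z
    using \<open>v \<noteq> w\<close> by (auto simp: face_chart_def cone_point_def edge_point_def vertex_point_def)
  have gf: "?g (face_chart a v w z) = z" if "z \<in> sector a" for z
    using a \<open>v \<noteq> w\<close> by (cases "z = 0") (auto simp: fc rcis_cmod_Arg algebra_simps)
  have fC: "face_chart a v w z \<in> ?C" if "z \<in> sector a" for z
    unfolding C using sector_props[OF a that] a by (auto simp: fc)
  have gC: "?g p \<in> sector a" if "p \<in> ?C" for p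
  proof -
    have p: "0 \<le> p v" "0 \<le> p w" using that unfolding C by auto
    have "p w / (p v + p w) \<le> 1" using p by (auto simp: divide_le_eq_1)
    then have "a * (p w / (p v + p w)) \<le> a" using a by (intro mult_left_le) auto
    then show ?thesis unfolding sector_def using a p by fastforce
  qed
  have fg: "face_chart a v w (?g p) = p" if "p \<in> ?C" for p
  proof -
    have p: "0 \<le> p v" "0 \<le> p w" "\<And>u. u \<notin> {v,w} \<Longrightarrow> p u = 0" using that unfolding C by auto
    show ?thesis
    proof (cases "p v + p w = 0")
      case True
      then have "p v = 0" "p w = 0" using p by auto
      then show ?thesis using p by (auto simp: fc fun_eq_iff)
    next
      case False
      define r where "r = p v + p w"
      have r: "0 < r" using False p by (simp add: r_def)
      have "p w / r \<le> 1" using p r by (simp add: r_def)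
      then have 1: "a * (p w / r) \<le> a" using a by (intro mult_left_le) auto
      have 2: "0 \<le> a * (p w / r)" using a p r by simp
      have "a * (p w / r) \<in> {-pi<..pi}" using 1 2 a pi_gt_zero by (simp del: pi_gt_zero)
      then have A: "Arg (rcis r (a * (p w / r))) = a * (p w / r)"
        using r by (rule Arg_rcis)
      have "r * (1 - p w / r) = p v" using r by (simp add: field_simps r_def)
      then show ?thesis
        unfolding r_def[symmetric] fc A using r a p by (auto simp: fun_eq_iff)
    qed
  qed
  have cf0: "continuous_on (sector a) (\<lambda>z. cmod z * (Arg z / a))"
    unfolding continuous_on_eq_continuous_within
  proof
    fix z assume z: "z \<in> sector a"
    show "continuous (at z within sector a) (\<lambda>z. cmod z * (Arg z / a))"
    proof (cases "z = 0")
      case True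
      show ?thesis
      proof (rule continuous_within_null_comparison[where k = "\<lambda>z. z"])
        show "\<forall>y\<in>sector a. norm (cmod y * (Arg y / a)) \<le> norm y"
        proof
          fix y assume y: "y \<in> sector a"
          have "\<bar>Arg y / a\<bar> \<le> 1" using sector_props[OF a y] a by (simp add: divide_le_eq_1)
          then show "norm (cmod y * (Arg y / a)) \<le> norm y"
            using mult_left_le[of "\<bar>Arg y / a\<bar>" "cmod y"] by (simp add: abs_mult)
        qed
      qed (use True in auto)
    next
      case False
      have "z \<notin> \<real>\<^sub>\<le>\<^sub>0"
      proof
        assume "z \<in> \<real>\<^sub>\<le>\<^sub>0"
        then have "Arg z = pi" using False
          by (auto simp: Arg_eq_pi complex_nonpos_Reals_iff complex_eq_iff)
        with sector_props[OF a z] a show False by simp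
      qed
      then show ?thesis using a
        by (intro continuous_intros continuous_within_Arg) auto
    qed
  qed
  have cf: "continuous_on (sector a) (face_chart a v w)"
  proof (rule continuous_on_coordinatewise_then_product)
    fix u
    have "continuous_on (sector a) (\<lambda>z. cmod z - cmod z * (Arg z / a))"
      by (intro continuous_intros cf0)
    then have "continuous_on (sector a) (\<lambda>z. cmod z * (1 - Arg z / a))"
      by (simp add: right_diff_distrib)
    then show "continuous_on (sector a) (\<lambda>z. face_chart a v w z u)"
      unfolding fc using cf0 by (cases "u = v"; cases "u = w") (simp_all del: times_divide_eq_right)
  qed
  have cg: "continuous_on ?C ?g"
    unfolding continuous_on_def
  proof
    fix p assume p: "p \<in> ?C"
    have co: "((\<lambda>q. q u) \<longlongrightarrow> p u) (at p within ?C)" for u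
      using continuous_on_subset[OF continuous_on_product_coordinates[of u] subset_UNIV] p
      by (auto simp: continuous_on_def)
    show "(?g \<longlongrightarrow> ?g p) (at p within ?C)"
    proof (cases "p v + p w = 0")
      case True
      have "((\<lambda>q. norm (q v + q w)) \<longlongrightarrow> norm (p v + p w)) (at p within ?C)"
        by (intro tendsto_intros co)
      then have "((\<lambda>q. norm (q v + q w)) \<longlongrightarrow> 0) (at p within ?C)"
        using True by simp
      then have "(?g \<longlongrightarrow> 0) (at p within ?C)"
        by (rule Lim_null_comparison[rotated]) simp
      then show ?thesis using True by simp
    next
      case False
      then show ?thesis
        unfolding rcis_def cis_conv_exp by (intro tendsto_intros co) auto
    qed
  qed
  show ?thesis
    unfolding homeomorphism_def
  proof (intro conjI ballI)
    show "face_chart a v w ` sector a = ?C" using fC gC fg by (metis image_eqI image_subsetI subsetI subset_antisym)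
    show "?g ` ?C = sector a" using fC gC gf by (metis (no_types, lifting) image_eqI image_subsetI subsetI subset_antisym)
  qed (use gf fg cf cg in blast)+
qed

lemma continuous_on_graph_cone_iff:
  fixes f :: "('v \<Rightarrow> real) \<Rightarrow> 'b::topological_space"
  assumes G: "finite_connected_graph V E" and "E \<noteq> {}"
  shows "continuous_on (graph_cone V E) f \<longleftrightarrow> (\<forall>e\<in>E. continuous_on (cone_over (std_simplex e)) f)"
proof -
  have finE: "finite E" and eV: "\<And>e. e \<in> E \<Longrightarrow> e \<subseteq> V \<and> finite e \<and> e \<noteq> {}"
  proof -
    have "E \<subseteq> Pow V" "finite V" using G unfolding finite_connected_graph_def by auto
    then show "finite E" by (meson finite_Pow_iff finite_subset)
    show "\<And>e. e \<in> E \<Longrightarrow> e \<subseteq> V \<and> finite e \<and> e \<noteq> {}"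
      using G unfolding finite_connected_graph_def
      by (metis card.infinite card.empty zero_neq_numeral)
  qed
  have inc: "\<exists>e\<in>E. v \<in> e" if v: "v \<in> V" for v
  proof -
    obtain e u where e: "e \<in> E" "u \<in> e" "u \<in> V" using \<open>E \<noteq> {}\<close> eV by blast
    have "(v, u) \<in> {(a, b). {a, b} \<in> E}\<^sup>*"
      using G v e unfolding finite_connected_graph_def by blast
    then show ?thesis
      by (cases rule: converse_rtranclE) (use e in auto)
  qed
  have 1: "graph_cone V E = (\<Union>e\<in>E. cone_over (std_simplex e))"
  proof -
    have sub: "std_simplex {v} \<subseteq> std_simplex e" if "v \<in> e" "e \<in> E" for v e
    proof
      fix x assume x: "x \<in> std_simplex {v}"
      have "(\<Sum>u\<in>e. x u) = (\<Sum>u\<in>{v}. x u)"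
        using eV[OF that(2)] that x by (intro sum.mono_neutral_right) (auto simp: std_simplex_def)
      then show "x \<in> std_simplex e" using x that by (auto simp: std_simplex_def)
    qed
    have "(\<Union>v\<in>V. std_simplex {v}) \<subseteq> (\<Union>e\<in>E. std_simplex e)"
    proof (rule UN_least)
      fix v assume "v \<in> V"
      then obtain e where e: "e \<in> E" "v \<in> e" using inc by auto
      show "std_simplex {v} \<subseteq> (\<Union>e\<in>E. std_simplex e)"
        using sub[OF e(2,1)] e(1) by (rule order_trans[OF _ UN_upper])
    qed
    then have "realization V E = (\<Union>e\<in>E. std_simplex e)"
      unfolding realization_def by (rule Un_absorb1)
    then show ?thesis unfolding graph_cone_def cone_over_def by auto
  qed
  have cl: "closed (cone_over (std_simplex e))" if "e \<in> E" for e
  proof -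
    have co: "continuous_on UNIV (\<lambda>p. p u)" for u :: 'v
      by (rule continuous_on_product_coordinates)
    have "cone_over (std_simplex e) = (\<Inter>u. {p. 0 \<le> p u}) \<inter> (\<Inter>u\<in>-e. {p. p u = 0})"
      using eV[OF that] by (subst cone_over_std_simplex) auto
    moreover have "closed \<dots>"
      by (intro closed_Int closed_INT ballI closed_Collect_le closed_Collect_eq continuous_on_const co)
    ultimately show ?thesis by simp
  qed
  show ?thesis
    unfolding 1
    using continuous_on_closed_Union[OF finE, of "\<lambda>e. cone_over (std_simplex e)" f] cl
    by (auto intro: continuous_on_subset)
qed

end

theory Submission
  imports Defs
begin

text \<open>Write \<open>a\<close> and \<open>b\<close> for the angles of a face \<open>{v, w}\<close> in the domain and in the target. In
  polar coordinates a homogeneous map of degree \<open>\<alpha>\<close> is \<open>t powr \<alpha> * g \<eta>\<close>, and it is harmonic iff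
  \<open>g'' = - \<alpha>\<^sup>2 * g\<close>. As \<open>\<alpha> * a < pi\<close>, the boundary values \<open>g 0 = \<rho> v\<close> and
  \<open>g a = \<rho> w * cis b\<close> determine \<open>g\<close>, and
  \<open>Re (g' 0) = \<alpha> * (\<rho> w * cos b - \<rho> v * cos (\<alpha> * a)) / sin (\<alpha> * a)\<close>. With constant angles
  the map is therefore balanced iff \<open>\<Sum>w. cos \<phi>\<^sub>0 * \<rho> w - cos (\<alpha> * \<theta>\<^sub>0) * \<rho> v = 0\<close>, summed over the
  neighbours \<open>w\<close> of \<open>v\<close>, for every \<open>v\<close>. Adding these equations over all \<open>v\<close> gives
  \<open>cos \<phi>\<^sub>0 = cos (\<alpha> * \<theta>\<^sub>0)\<close> unless \<open>\<rho> = 0\<close>. If the two cosines agree and are nonzero, \<open>\<rho>\<close> is a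
  harmonic function on the graph, hence constant by the maximum principle.\<close>

section \<open>Homogeneous harmonic functions on a sector\<close>

text \<open>\<open>Arg\<close> is continuous off the nonpositive reals, so the points there with
  argument strictly between 0 and \<open>a\<close> form an open subset of the sector.\<close>

lemma open_sector_subset_interior:
  assumes "0 < r" "0 < \<eta>" "\<eta> < a" "a < pi"
  shows "rcis r \<eta> \<in> interior (sector a)"
proof -
  let ?U = "{z \<in> - \<real>\<^sub>\<le>\<^sub>0. Arg z \<in> {0<..<a}}"
  have "continuous_on (- \<real>\<^sub>\<le>\<^sub>0) Arg"
    by (auto intro!: continuous_at_imp_continuous_on continuous_at_Arg)
  then have "open ?U"
    using continuous_open_preimage[of "- \<real>\<^sub>\<le>\<^sub>0" Arg "{0<..<a}"] by (simp add: vimage_def Int_def open_Compl)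
  moreover have "?U \<subseteq> sector a"
  proof
    fix z assume "z \<in> ?U"
    then show "z \<in> sector a"
      unfolding sector_def mem_Collect_eq
      by (intro exI[of _ "cmod z"] exI[of _ "Arg z"]) (auto simp: rcis_cmod_Arg)
  qed
  moreover have A: "Arg (rcis r \<eta>) = \<eta>" using assms by (intro Arg_rcis) auto
  have "rcis r \<eta> \<notin> \<real>\<^sub>\<le>\<^sub>0"
    using assms sin_gt_zero[of \<eta>] by (auto simp: complex_nonpos_Reals_iff)
  then have "rcis r \<eta> \<in> ?U" using A assms by auto
  ultimately show ?thesis by (meson interiorI)
qed

text \<open>Every ball around 0 contains a negative real number, whose argument pi exceeds
  \<open>a\<close>.\<close>

lemma zero_notin_interior_sector:
  assumes "0 < a" "a < pi"
  shows "0 \<notin> interior (sector a)"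
proof
  assume "0 \<in> interior (sector a)"
  then obtain e where e: "0 < e" "cball 0 e \<subseteq> sector a"
    by (auto simp: mem_interior_cball)
  then have "- complex_of_real e \<in> sector a" by (auto simp: subset_iff)
  moreover have "Arg (- complex_of_real e) = pi"
    using e by (simp add: Arg_eq_pi)
  ultimately show False using sector_props[of a "- complex_of_real e"] assms by simp
qed

text \<open>The trace can be computed in any orthonormal basis. For the Hessian at
  \<open>cis t\<close>, the radial and tangential directions split the Laplacian in polar
  form.\<close>

lemma trace_orthonormal_complex:
  assumes "linear L" 
  shows "L (cis t) \<bullet> cis t + L (\<i> * cis t) \<bullet> (\<i> * cis t) = (\<Sum>b\<in>Basis. L b \<bullet> b)"
proof -
  have 1: "cis t = cos t *\<^sub>R 1 + sin t *\<^sub>R \<i>" "\<i> * cis t = (- sin t) *\<^sub>R 1 + cos t *\<^sub>R \<i>"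
    by (auto simp: complex_eq_iff)
  have 2: "L (cis t) = cos t *\<^sub>R L 1 + sin t *\<^sub>R L \<i>" "L (\<i> * cis t) = (- sin t) *\<^sub>R L 1 + cos t *\<^sub>R L \<i>"
    using assms by (subst 1(1) 1(2), simp only: linear_add linear_scale)+
  have "L (cis t) \<bullet> cis t + L (\<i> * cis t) \<bullet> (\<i> * cis t) = ((cos t)\<^sup>2 + (sin t)\<^sup>2) * (Re (L 1) + Im (L \<i>))"
    unfolding 2 by (simp add: inner_complex_def algebra_simps power2_eq_square
        del: sin_cos_squared_add sin_cos_squared_add2 sin_cos_squared_add3)
  then show ?thesis by (simp add: Basis_complex_def inner_complex_def)
qed

text \<open>In polar coordinates the Laplacian of r^\<alpha> h(\<eta>) is r^(\<alpha>-2) (h'' +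
  \<alpha>^2 h). Smoothness of \<open>h\<close> is not given beforehand; it is read off from the
  gradient \<open>D\<close> and the Hessian \<open>H\<close> of \<open>u\<close> along the unit
  circle.\<close>

lemma homogeneous_harmonic_angular_ode:
  assumes harm: "harmonic_fun_on u S"
    and S: "\<And>r \<eta>. 0 < r \<Longrightarrow> 0 < \<eta> \<Longrightarrow> \<eta> < a \<Longrightarrow> rcis r \<eta> \<in> S"
    and u: "\<And>r \<eta>. 0 < r \<Longrightarrow> 0 < \<eta> \<Longrightarrow> \<eta> < a \<Longrightarrow> u (rcis r \<eta>) = r powr \<alpha> * h \<eta>"
  obtains h' where "\<And>\<eta>. 0 < \<eta> \<Longrightarrow> \<eta> < a \<Longrightarrow> (h has_real_derivative h' \<eta>) (at \<eta>)"
    and "\<And>\<eta>. 0 < \<eta> \<Longrightarrow> \<eta> < a \<Longrightarrow> (h' has_real_derivative - (\<alpha>\<^sup>2 * h \<eta>)) (at \<eta>)"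
proof -
  obtain D H where D: "\<And>z. z \<in> S \<Longrightarrow> (u has_derivative (\<lambda>h. D z \<bullet> h)) (at z)"
    and H: "\<And>z. z \<in> S \<Longrightarrow> (D has_derivative H z) (at z)"
    and lap: "\<And>z. z \<in> S \<Longrightarrow> (\<Sum>b\<in>Basis. H z b \<bullet> b) = 0"
    using harm unfolding harmonic_fun_on_def by blast
  \<comment> \<open>The tangential component of the gradient: \<open>\<i> * cis \<eta>\<close> is
    the velocity of the unit circle at \<open>cis \<eta>\<close>.\<close>
  define h' where "h' = (\<lambda>\<eta>. D (cis \<eta>) \<bullet> (\<i> * cis \<eta>))"
  have cisS: "cis \<eta> \<in> S" if "0 < \<eta>" "\<eta> < a" for \<eta>
    using S[of 1 \<eta>] that by (simp add: rcis_def)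
  have 1: "(h has_real_derivative h' \<eta>) (at \<eta>)" if \<eta>: "0 < \<eta>" "\<eta> < a" for \<eta>
  proof -
    have "((\<lambda>x. u (cis x)) has_derivative (\<lambda>x. D (cis \<eta>) \<bullet> (x *\<^sub>R (\<i> * cis \<eta>)))) (at \<eta>)"
      by (rule has_derivative_compose[OF has_derivative_cis[OF has_derivative_ident] D[OF cisS[OF \<eta>]]])
    then have "((\<lambda>x. u (cis x)) has_real_derivative h' \<eta>) (at \<eta>)"
      unfolding has_field_derivative_def h'_def by (simp add: mult_commute_abs)
    moreover have "\<forall>\<^sub>F x in nhds \<eta>. u (cis x) = h x"
      using eventually_nhds_in_open[of "{0<..<a}" \<eta>] \<eta> 
      by (auto elim!: eventually_mono simp: u[of 1, unfolded rcis_def, simplified])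
    ultimately show ?thesis by (simp add: DERIV_cong_ev)
  qed
  have 2: "(h' has_real_derivative - (\<alpha>\<^sup>2 * h \<eta>)) (at \<eta>)" if \<eta>: "0 < \<eta>" "\<eta> < a" for \<eta>
  proof -
    have lin: "linear (H (cis \<eta>))" by (rule has_derivative_linear[OF H[OF cisS[OF \<eta>]]])
    have rad: "((\<lambda>r. rcis r \<eta>) has_derivative (\<lambda>x. x *\<^sub>R cis \<eta>)) (at r)" for r
      unfolding rcis_def by (auto intro!: derivative_eq_intros simp: scaleR_conv_of_real)
    \<comment> \<open>The radial derivative is computed once from the gradient and once from the
      power of r. It is needed for all r > 0, since \<open>R2\<close> differentiates it again at r =
      1.\<close>
    have R1: "D (rcis r \<eta>) \<bullet> cis \<eta> = \<alpha> * r powr (\<alpha> - 1) * h \<eta>" if "0 < r" for r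
    proof -
      have "((\<lambda>r. u (rcis r \<eta>)) has_derivative (\<lambda>x. D (rcis r \<eta>) \<bullet> (x *\<^sub>R cis \<eta>))) (at r)"
        by (rule has_derivative_compose[OF rad D[OF S[OF that \<eta>]]])
      then have "((\<lambda>r. u (rcis r \<eta>)) has_real_derivative D (rcis r \<eta>) \<bullet> cis \<eta>) (at r)"
        unfolding has_field_derivative_def by (simp add: mult_commute_abs)
      moreover have "\<forall>\<^sub>F x in nhds r. u (rcis x \<eta>) = x powr \<alpha> * h \<eta>"
        using eventually_nhds_in_open[of "{0<..}" r] that \<eta>
        by (auto elim!: eventually_mono simp: u)
      ultimately have "((\<lambda>x. x powr \<alpha> * h \<eta>) has_real_derivative D (rcis r \<eta>) \<bullet> cis \<eta>) (at r)"
        by (simp add: DERIV_cong_ev)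
      moreover have "((\<lambda>x. x powr \<alpha> * h \<eta>) has_real_derivative \<alpha> * r powr (\<alpha> - 1) * h \<eta>) (at r)"
        using that by (auto intro!: derivative_eq_intros)
      ultimately show ?thesis by (rule DERIV_unique)
    qed
    have R2: "H (cis \<eta>) (cis \<eta>) \<bullet> cis \<eta> = \<alpha> * (\<alpha> - 1) * h \<eta>"
    proof -
      have H1: "(D has_derivative H (cis \<eta>)) (at (rcis 1 \<eta>))"
        using H[OF cisS[OF \<eta>]] by (simp add: rcis_def)
      have "((\<lambda>r. D (rcis r \<eta>)) has_derivative (\<lambda>x. H (cis \<eta>) (x *\<^sub>R cis \<eta>))) (at 1)"
        by (rule has_derivative_compose[OF rad H1])
      then have "((\<lambda>r. D (rcis r \<eta>) \<bullet> cis \<eta>) has_derivative (\<lambda>x. H (cis \<eta>) (x *\<^sub>R cis \<eta>) \<bullet> cis \<eta>)) (at 1)"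
        by (rule has_derivative_inner_left)
      then have "((\<lambda>r. D (rcis r \<eta>) \<bullet> cis \<eta>) has_real_derivative H (cis \<eta>) (cis \<eta>) \<bullet> cis \<eta>) (at 1)"
        unfolding has_field_derivative_def using lin by (simp add: mult_commute_abs linear_scale)
      moreover have "\<forall>\<^sub>F x in nhds 1. D (rcis x \<eta>) \<bullet> cis \<eta> = \<alpha> * x powr (\<alpha> - 1) * h \<eta>"
        using eventually_nhds_in_open[of "{0<..}" "1::real"]
        by (auto elim!: eventually_mono simp: R1)
      ultimately have "((\<lambda>x. \<alpha> * x powr (\<alpha> - 1) * h \<eta>) has_real_derivative
          H (cis \<eta>) (cis \<eta>) \<bullet> cis \<eta>) (at 1)"
        by (simp add: DERIV_cong_ev)
      moreover have "((\<lambda>x. \<alpha> * x powr (\<alpha> - 1) * h \<eta>) has_real_derivative \<alpha> * (\<alpha> - 1) * h \<eta>) (at 1)"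
        by (auto intro!: derivative_eq_intros)
      ultimately show ?thesis by (rule DERIV_unique)
    qed
    have "((\<lambda>x. D (cis x)) has_derivative (\<lambda>x. H (cis \<eta>) (x *\<^sub>R (\<i> * cis \<eta>)))) (at \<eta>)"
      by (rule has_derivative_compose[OF has_derivative_cis[OF has_derivative_ident] H[OF cisS[OF \<eta>]]])
    moreover have "((\<lambda>x. \<i> * cis x) has_derivative (\<lambda>x. \<i> * (x *\<^sub>R (\<i> * cis \<eta>)))) (at \<eta>)"
      by (intro has_derivative_mult_right has_derivative_cis has_derivative_ident)
    ultimately have "(h' has_derivative (\<lambda>x. D (cis \<eta>) \<bullet> (\<i> * (x *\<^sub>R (\<i> * cis \<eta>)))
        + H (cis \<eta>) (x *\<^sub>R (\<i> * cis \<eta>)) \<bullet> (\<i> * cis \<eta>))) (at \<eta>)"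
      unfolding h'_def by (rule has_derivative_inner)
    moreover have "D (cis \<eta>) \<bullet> (\<i> * (x *\<^sub>R (\<i> * cis \<eta>))) + H (cis \<eta>) (x *\<^sub>R (\<i> * cis \<eta>)) \<bullet> (\<i> * cis \<eta>)
        = x * (H (cis \<eta>) (\<i> * cis \<eta>) \<bullet> (\<i> * cis \<eta>) - D (cis \<eta>) \<bullet> cis \<eta>)" for x
      using lin by (simp add: linear_scale inner_complex_def algebra_simps)
    ultimately have "(h' has_real_derivative
        H (cis \<eta>) (\<i> * cis \<eta>) \<bullet> (\<i> * cis \<eta>) - D (cis \<eta>) \<bullet> cis \<eta>) (at \<eta>)"
      unfolding has_field_derivative_def by (simp add: mult_commute_abs)
    \<comment> \<open>The vanishing trace turns the tangential second derivative into minus the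
      radial one, so the value is -\<alpha>(\<alpha>-1)h - \<alpha>h = -\<alpha>^2 h.\<close>
    moreover have "H (cis \<eta>) (\<i> * cis \<eta>) \<bullet> (\<i> * cis \<eta>) - D (cis \<eta>) \<bullet> cis \<eta> = - (\<alpha>\<^sup>2 * h \<eta>)"
      using trace_orthonormal_complex[OF lin, of \<eta>] lap[OF cisS[OF \<eta>]] R1[of 1] R2
      by (simp add: rcis_def algebra_simps power2_eq_square)
    ultimately show ?thesis by simp
  qed
  show thesis by (rule that[OF 1 2])
qed

text \<open>Variation of constants gives h = p cos(\<alpha> x) + q sin(\<alpha> x). The two boundary
  values fix p and q because sin(\<alpha> a) is nonzero for 0 < \<alpha> a < pi.\<close>

lemma oscillator_boundary_unique:
  assumes a: "0 < a" and \<alpha>: "0 < \<alpha>" "\<alpha> * a < pi"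
    and cont: "continuous_on {0..a} h"
    and h': "\<And>\<eta>. 0 < \<eta> \<Longrightarrow> \<eta> < a \<Longrightarrow> (h has_real_derivative h' \<eta>) (at \<eta>)"
    and h'': "\<And>\<eta>. 0 < \<eta> \<Longrightarrow> \<eta> < a \<Longrightarrow> (h' has_real_derivative - (\<alpha>\<^sup>2 * h \<eta>)) (at \<eta>)"
    and \<eta>: "\<eta> \<in> {0..a}"
  shows "h \<eta> = (h 0 * sin (\<alpha> * (a - \<eta>)) + h a * sin (\<alpha> * \<eta>)) / sin (\<alpha> * a)"
proof -
  \<comment> \<open>If h = p cos(\<alpha> x) + q sin(\<alpha> x), then \<open>P\<close> and
    \<open>Q\<close> recover p and q from h and h'. The differential equation makes both
    constant.\<close>
  define P where "P = (\<lambda>x. h x * cos (\<alpha> * x) - h' x * sin (\<alpha> * x) / \<alpha>)"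
  define Q where "Q = (\<lambda>x. h x * sin (\<alpha> * x) + h' x * cos (\<alpha> * x) / \<alpha>)"
  have dP: "(P has_real_derivative 0) (at x)" and dQ: "(Q has_real_derivative 0) (at x)" if "x \<in> {0<..<a}" for x
    unfolding P_def Q_def using that \<alpha>
    by (auto intro!: derivative_eq_intros h' h'' simp: field_simps power2_eq_square)
  obtain p where p: "\<And>x. x \<in> {0<..<a} \<Longrightarrow> P x = p"
    using has_field_derivative_0_imp_constant_on[of "{0<..<a}" P, OF dP]
    by (auto simp: constant_on_def)
  obtain q where q: "\<And>x. x \<in> {0<..<a} \<Longrightarrow> Q x = q"
    using has_field_derivative_0_imp_constant_on[of "{0<..<a}" Q, OF dQ]
    by (auto simp: constant_on_def)
  have int: "h x - (p * cos (\<alpha> * x) + q * sin (\<alpha> * x)) = 0" if "x \<in> {0<..<a}" for x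
  proof -
    have "p * cos (\<alpha> * x) + q * sin (\<alpha> * x) = h x * ((cos (\<alpha> * x))\<^sup>2 + (sin (\<alpha> * x))\<^sup>2)"
      unfolding p[OF that, symmetric] q[OF that, symmetric] P_def Q_def
      by (simp add: algebra_simps power2_eq_square del: sin_cos_squared_add sin_cos_squared_add2 sin_cos_squared_add3)
    then show ?thesis by simp
  qed
  have cl: "closure {0<..<a} = {0..a}" using a by simp
  \<comment> \<open>The equation is known only on the open interval; continuity of \<open>h\<close>
    carries its solution to the endpoints.\<close>
  have eq: "h x = p * cos (\<alpha> * x) + q * sin (\<alpha> * x)" if "x \<in> {0..a}" for x
  proof -
    have "h x - (p * cos (\<alpha> * x) + q * sin (\<alpha> * x)) = 0"
      by (rule continuous_constant_on_closure[of "{0<..<a}"])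
         (use cl cont int that in \<open>auto intro!: continuous_intros\<close>)
    then show ?thesis by simp
  qed
  have s: "sin (\<alpha> * a) \<noteq> 0" using sin_gt_zero[of "\<alpha> * a"] a \<alpha> by simp
  have "h 0 = p" "h a = p * cos (\<alpha> * a) + q * sin (\<alpha> * a)" using eq[of 0] eq[of a] a by auto
  then show ?thesis using eq[OF \<eta>] s by (simp add: field_simps sin_diff)
qed

section \<open>Coordinate representations\<close>

lemma edge_neq: "finite_connected_graph V E \<Longrightarrow> {v, w} \<in> E \<Longrightarrow> v \<noteq> w"
  unfolding finite_connected_graph_def by (auto split: if_splits)

lemma edge_vertices: "finite_connected_graph V E \<Longrightarrow> {v, w} \<in> E \<Longrightarrow> v \<in> V \<and> w \<in> V"
  unfolding finite_connected_graph_def by auto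

lemma vertex_has_neighbour:
  assumes "finite_connected_graph V E" "E \<noteq> {}" "v \<in> V"
  obtains w where "{v, w} \<in> E"
proof -
  obtain e where e: "e \<in> E" "e \<subseteq> V" "card e = 2"
    using assms unfolding finite_connected_graph_def by blast
  then obtain u x where ux: "e = {u, x}" by (auto simp: card_2_iff)
  have "(v, u) \<in> {(a, b). {a, b} \<in> E}\<^sup>*"
    using assms e ux unfolding finite_connected_graph_def by blast
  then show ?thesis
    by (cases rule: converse_rtranclE) (use that e ux in auto)
qed

text \<open>Replaces the inverse chosen in \<open>coord_rep\<close> by the explicit inverse of the
  chart.\<close>

lemma inv_into_face_chart:
  assumes "0 < a" "a < pi" "v \<noteq> w" "p \<in> cone_over (std_simplex {v, w})"
  shows "inv_into (sector a) (face_chart a v w) p = rcis (p v + p w) (a * (p w / (p v + p w)))"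
proof -
  let ?g = "\<lambda>p. rcis (p v + p w) (a * (p w / (p v + p w)))"
  note hom = homeomorphism_face_chart[OF assms(1-3)]
  have "inj_on (face_chart a v w) (sector a)"
    by (rule inj_on_inverseI[where g = ?g]) (rule homeomorphism_apply1[OF hom])
  moreover have "?g p \<in> sector a" "face_chart a v w (?g p) = p"
    using homeomorphism_image2[OF hom] homeomorphism_apply2[OF hom assms(4)] assms(4) by auto
  ultimately show ?thesis by (rule inv_into_f_eq)
qed

lemma cone_over_edge_subset: "e \<in> E \<Longrightarrow> cone_over (std_simplex e) \<subseteq> graph_cone V E"
  unfolding graph_cone_def cone_over_def realization_def by blast

lemma face_chart_rcis:
  assumes "0 < a" "a < pi" "0 \<le> \<eta>" "\<eta> \<le> a" "0 \<le> t"
  shows "face_chart a v w (rcis t \<eta>) = cone_point (edge_point v w (\<eta> / a)) t"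
proof (cases "t = 0")
  case False
  then have "Arg (rcis t \<eta>) = \<eta>" using assms by (intro Arg_rcis) auto
  then show ?thesis using assms by (simp add: face_chart_def)
qed (simp add: face_chart_def cone_point_def)

lemma edge_point_in_simplex:
  assumes "v \<noteq> w" "0 \<le> s" "s \<le> 1"
  shows "edge_point v w s \<in> std_simplex {v, w}"
  using assms by (auto simp: std_simplex_def edge_point_def vertex_point_def)

text \<open>Comparing radius t with radius 1 eliminates the unknown functions y and s from the
  definition.\<close>

lemma homogeneous_map_scale:
  assumes hom: "homogeneous_map V E \<alpha> f" and x: "x \<in> realization V E" and t: "0 \<le> t"
  shows "f (cone_point x t) = (\<lambda>u. t powr \<alpha> * f (cone_point x 1) u)"
proof -
  from hom obtain y s where
    "\<forall>x\<in>realization V E. \<forall>t\<ge>0. f (cone_point x t) = cone_point (y x) (s x * t powr \<alpha>)"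
    unfolding homogeneous_map_def by (elim conjE exE)
  from bspec[OF this x] have "f (cone_point x t) = cone_point (y x) (s x * t powr \<alpha>)" if "0 \<le> t" for t
    using that by simp
  from this[of t] this[of 1] show ?thesis using t by (simp add: cone_point_def mult_ac)
qed

section \<open>The coordinate representation of a homogeneous map on one face\<close>

context
  fixes V :: "'v set" and E \<alpha> f \<theta> \<phi> v w
  assumes G: "finite_connected_graph V E" and vw: "{v, w} \<in> E" and hom: "homogeneous_map V E \<alpha> f"
    and \<theta>: "0 < \<theta> {v, w}" "\<theta> {v, w} < pi" and \<phi>: "0 < \<phi> {v, w}" "\<phi> {v, w} < pi"
begin

lemma face_invariant:
  assumes "p \<in> cone_over (std_simplex {v, w})"
  shows "f p \<in> cone_over (std_simplex {v, w})"
  using hom vw assms unfolding homogeneous_map_def by blast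

text \<open>The map preserves the face, so its value lies in the range of the target chart, where
  \<open>inv_into\<close> is a right inverse.\<close>

lemma face_chart_coord_rep:
  assumes z: "z \<in> sector (\<theta> {v, w})"
  shows "face_chart (\<phi> {v, w}) v w (coord_rep \<theta> \<phi> f v w z) = f (face_chart (\<theta> {v, w}) v w z)"
proof -
  note ne = edge_neq[OF G vw]
  have "face_chart (\<theta> {v, w}) v w z \<in> cone_over (std_simplex {v, w})"
    using homeomorphism_image1[OF homeomorphism_face_chart[OF \<theta> ne]] z by auto
  then have "f (face_chart (\<theta> {v, w}) v w z) \<in> face_chart (\<phi> {v, w}) v w ` sector (\<phi> {v, w})"
    unfolding homeomorphism_image1[OF homeomorphism_face_chart[OF \<phi> ne]] by (rule face_invariant)
  then show ?thesis unfolding coord_rep_def by (rule f_inv_into_f)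
qed

lemma continuous_on_coord_rep: "continuous_on (sector (\<theta> {v, w})) (coord_rep \<theta> \<phi> f v w)"
proof -
  note ne = edge_neq[OF G vw]
  let ?C = "cone_over (std_simplex {v, w})"
  let ?g = "\<lambda>p. rcis (p v + p w) (\<phi> {v, w} * (p w / (p v + p w)))"
  note h\<theta> = homeomorphism_face_chart[OF \<theta> ne] and h\<phi> = homeomorphism_face_chart[OF \<phi> ne]
  have cf: "continuous_on ?C f"
  proof (rule continuous_on_subset)
    show "continuous_on (graph_cone V E) f" using hom by (simp add: homogeneous_map_def)
  qed (rule cone_over_edge_subset[OF vw])
  have img: "face_chart (\<theta> {v, w}) v w ` sector (\<theta> {v, w}) = ?C"
    by (rule homeomorphism_image1[OF h\<theta>])
  have "f ` ?C \<subseteq> ?C" using face_invariant by blast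
  then have "continuous_on ?C (?g \<circ> f)"
    by (intro continuous_on_compose cf continuous_on_subset[OF homeomorphism_cont2[OF h\<phi>]])
  then have "continuous_on (sector (\<theta> {v, w})) ((?g \<circ> f) \<circ> face_chart (\<theta> {v, w}) v w)"
    by (rule continuous_on_compose[OF homeomorphism_cont1[OF h\<theta>], unfolded img])
  moreover have "((?g \<circ> f) \<circ> face_chart (\<theta> {v, w}) v w) z = coord_rep \<theta> \<phi> f v w z"
    if "z \<in> sector (\<theta> {v, w})" for z
    unfolding coord_rep_def comp_apply
    by (rule inv_into_face_chart[OF \<phi> ne face_invariant, symmetric]) (use img that in blast)
  ultimately show ?thesis by (simp cong: continuous_on_cong)
qed

text \<open>Scaling a point of the face multiplies \<open>p v + p w\<close> and leaves the ratio
  \<open>p w / (p v + p w)\<close>, hence the angle, unchanged.\<close>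

lemma coord_rep_homogeneous:
  assumes "0 \<le> t" "0 \<le> \<eta>" "\<eta> \<le> \<theta> {v, w}"
  shows "coord_rep \<theta> \<phi> f v w (rcis t \<eta>) = of_real (t powr \<alpha>) * coord_rep \<theta> \<phi> f v w (cis \<eta>)"
proof -
  note ne = edge_neq[OF G vw]
  let ?x = "edge_point v w (\<eta> / \<theta> {v, w})"
  have x: "?x \<in> std_simplex {v, w}"
    using assms \<theta> by (intro edge_point_in_simplex ne) auto
  then have xr: "?x \<in> realization V E" using vw unfolding realization_def by blast
  have C: "cone_point ?x t \<in> cone_over (std_simplex {v, w})" if "0 \<le> t" for t
    using x that unfolding cone_over_def by blast
  have *: "coord_rep \<theta> \<phi> f v w (rcis t \<eta>) = (let p = f (cone_point ?x t) in
      rcis (p v + p w) (\<phi> {v, w} * (p w / (p v + p w))))" if "0 \<le> t" for t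
    unfolding coord_rep_def face_chart_rcis[OF \<theta> assms(2,3) that] Let_def
    by (rule inv_into_face_chart[OF \<phi> ne face_invariant[OF C[OF that]]])
  have eq: "f (cone_point ?x t) = (\<lambda>u. t powr \<alpha> * f (cone_point ?x 1) u)"
    by (rule homogeneous_map_scale[OF hom xr assms(1)])
  show ?thesis
  \<comment> \<open>For t = 0 the ratio degenerates to 0 / 0, but the radius is 0 and the angle is
    irrelevant.\<close>
  proof (cases "t = 0")
    case True
    then show ?thesis using *[of t] unfolding eq by simp
  next
    case False
    then show ?thesis
      using *[of t] *[of 1] assms unfolding eq by (simp add: Let_def rcis_def flip: distrib_left)
  qed
qed

text \<open>The rays over \<open>v\<close> and \<open>w\<close> are preserved, so one barycentric
  coordinate of the image vanishes and the angle in the target is 0 or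
  \<open>\<phi> {v, w}\<close>.\<close>

lemma coord_rep_boundary:
  shows "coord_rep \<theta> \<phi> f v w 1 = f (vertex_point v) v" (is ?A)
    and "coord_rep \<theta> \<phi> f v w (cis (\<theta> {v, w})) = rcis (f (vertex_point w) w) (\<phi> {v, w})" (is ?B)
    and "0 \<le> f (vertex_point v) v" (is ?C)
proof -
  note ne = edge_neq[OF G vw]
  have vt: "f (vertex_point u) \<in> cone_over (std_simplex {u})" 
    "vertex_point u \<in> cone_over (std_simplex {v, w})" if "u \<in> {v, w}" for u
  proof -
    have "vertex_point u \<in> cone_over (std_simplex {u})"
      by (subst cone_over_std_simplex) (auto simp: vertex_point_def)
    moreover have "u \<in> V" using edge_vertices[OF G vw] that by auto
    ultimately show "f (vertex_point u) \<in> cone_over (std_simplex {u})"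
      using hom unfolding homogeneous_map_def by blast
    show "vertex_point u \<in> cone_over (std_simplex {v, w})"
      using that by (subst cone_over_std_simplex) (auto simp: vertex_point_def)
  qed
  have v0: "f (vertex_point v) w = 0" and w0: "f (vertex_point w) v = 0" 
    and nn: "0 \<le> f (vertex_point v) v"
    using vt(1)[of v] vt(1)[of w] ne by (auto simp: cone_over_std_simplex)
  have fc: "face_chart (\<theta> {v, w}) v w (rcis 1 0) = vertex_point v"
    "face_chart (\<theta> {v, w}) v w (rcis 1 (\<theta> {v, w})) = vertex_point w"
    by (subst face_chart_rcis; use \<theta> in \<open>simp add: cone_point_def edge_point_def\<close>)+
  show ?C by (rule nn)
  have "coord_rep \<theta> \<phi> f v w (rcis 1 0) = f (vertex_point v) v"
    unfolding coord_rep_def fc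
    using inv_into_face_chart[OF \<phi> ne face_invariant[OF vt(2)[of v]]] v0 by simp
  then show ?A by simp
  \<comment> \<open>If the image is the apex, the explicit inverse gives angle 0 instead of
    \<open>\<phi> {v, w}\<close>; at radius 0 both describe the origin.\<close>
  have "coord_rep \<theta> \<phi> f v w (rcis 1 (\<theta> {v, w})) = rcis (f (vertex_point w) w) (\<phi> {v, w})"
    unfolding coord_rep_def fc
    using inv_into_face_chart[OF \<phi> ne face_invariant[OF vt(2)[of w]]] w0
    by (cases "f (vertex_point w) w = 0") simp_all
  then show ?B by (simp add: rcis_def)
qed

end

section \<open>The explicit form of the coordinate representation\<close>

text \<open>The solution of \<open>g'' = - \<alpha>\<^sup>2 * g\<close> with \<open>g 0 = A\<close> and \<open>g a = B * cis b\<close>.\<close>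

definition polar_solution :: "real \<Rightarrow> real \<Rightarrow> real \<Rightarrow> real \<Rightarrow> real \<Rightarrow> real \<Rightarrow> complex" where
  "polar_solution \<alpha> a b A B \<eta> =
     complex_of_real (A * sin (\<alpha> * (a - \<eta>)) / sin (\<alpha> * a)) + rcis (B * sin (\<alpha> * \<eta>) / sin (\<alpha> * a)) b"

lemma rcis_in_sector: "0 \<le> r \<Longrightarrow> 0 \<le> \<eta> \<Longrightarrow> \<eta> \<le> a \<Longrightarrow> rcis r \<eta> \<in> sector a"
  unfolding sector_def by blast

lemma Re_polar_solution: "Re (polar_solution \<alpha> a b A B \<eta>) =
    (A * sin (\<alpha> * (a - \<eta>)) + (B * cos b) * sin (\<alpha> * \<eta>)) / sin (\<alpha> * a)"
  by (simp add: polar_solution_def add_divide_distrib)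

lemma Im_polar_solution: "Im (polar_solution \<alpha> a b A B \<eta>) = B * sin b * sin (\<alpha> * \<eta>) / sin (\<alpha> * a)"
  by (simp add: polar_solution_def)

text \<open>By homogeneity it suffices to treat radius 1. There the real and imaginary parts each
  solve the oscillator equation, with boundary values given by the images of the two
  vertices.\<close>

lemma coord_rep_formula:
  assumes G: "finite_connected_graph V E" and vw: "{v, w} \<in> E"
    and f: "homogeneous_harmonic_map V E \<theta> \<phi> \<alpha> f"
    and \<theta>: "0 < \<theta> {v, w}" "\<theta> {v, w} < pi" and \<phi>: "0 < \<phi> {v, w}" "\<phi> {v, w} < pi"
    and \<alpha>: "\<alpha> * \<theta> {v, w} < pi"
    and t: "0 \<le> t" and \<eta>: "0 \<le> \<eta>" "\<eta> \<le> \<theta> {v, w}"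
  shows "coord_rep \<theta> \<phi> f v w (rcis t \<eta>) =
    of_real (t powr \<alpha>) * polar_solution \<alpha> (\<theta> {v, w}) (\<phi> {v, w}) (f (vertex_point v) v) (f (vertex_point w) w) \<eta>"
proof -
  have hom: "homogeneous_map V E \<alpha> f"
    and harm: "harmonic_fun_on (\<lambda>z. Re (coord_rep \<theta> \<phi> f v w z)) (interior (sector (\<theta> {v, w})))"
      "harmonic_fun_on (\<lambda>z. Im (coord_rep \<theta> \<phi> f v w z)) (interior (sector (\<theta> {v, w})))"
    using f vw unfolding homogeneous_harmonic_map_def harmonic_map_def by auto
  have \<alpha>0: "0 < \<alpha>" using hom unfolding homogeneous_map_def by (elim conjE)
  let ?U = "coord_rep \<theta> \<phi> f v w" and ?a = "\<theta> {v, w}" and ?b = "\<phi> {v, w}"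
  note bdry = coord_rep_boundary[where \<theta>=\<theta> and \<phi>=\<phi>, OF G vw hom \<theta> \<phi>]
  note homog = coord_rep_homogeneous[where \<theta>=\<theta> and \<phi>=\<phi>, OF G vw hom \<theta> \<phi>]
  have "continuous_on {0..?a} (?U \<circ> cis)"
  proof (rule continuous_on_compose)
    have "cis ` {0..?a} \<subseteq> sector ?a"
      using rcis_in_sector[of 1 _ ?a] by (intro image_subsetI) (simp add: rcis_def)
    then show "continuous_on (cis ` {0..?a}) ?U"
      by (rule continuous_on_subset[OF continuous_on_coord_rep[where \<theta>=\<theta> and \<phi>=\<phi>, OF G vw hom \<theta> \<phi>]])
  qed (intro continuous_intros)
  then have cont: "continuous_on {0..?a} (\<lambda>x. ?U (cis x))" by (simp add: comp_def)
  \<comment> \<open>\<open>L\<close> stands for \<open>Re\<close> or \<open>Im\<close>; only real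
    homogeneity and continuity along the arc are used.\<close>
  have part: "L (?U (cis \<eta>)) = (L (?U (cis 0)) * sin (\<alpha> * (?a - \<eta>)) + L (?U (cis ?a)) * sin (\<alpha> * \<eta>)) / sin (\<alpha> * ?a)"
    if harmL: "harmonic_fun_on (\<lambda>z. L (?U z)) (interior (sector ?a))"
      and lin: "\<And>c z. L (complex_of_real c * z) = c * L z"
      and contL: "continuous_on {0..?a} (\<lambda>x. L (?U (cis x)))" for L :: "complex \<Rightarrow> real"
  proof -
    have sec: "rcis r x \<in> interior (sector ?a)" if "0 < r" "0 < x" "x < ?a" for r x
      using open_sector_subset_interior that \<theta> by blast
    have val: "L (?U (rcis r x)) = r powr \<alpha> * L (?U (cis x))" if "0 < r" "0 < x" "x < ?a" for r x
      using that by (simp add: homog lin)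
    obtain h' where "\<And>x. 0 < x \<Longrightarrow> x < ?a \<Longrightarrow> ((\<lambda>x. L (?U (cis x))) has_real_derivative h' x) (at x)"
      and "\<And>x. 0 < x \<Longrightarrow> x < ?a \<Longrightarrow> (h' has_real_derivative - (\<alpha>\<^sup>2 * L (?U (cis x)))) (at x)"
      using homogeneous_harmonic_angular_ode[OF harmL sec val] by blast
    then show ?thesis
      using \<eta> by (intro oscillator_boundary_unique[OF \<theta>(1) \<alpha>0 \<alpha> contL]) auto
  qed
  have "?U (cis \<eta>) = polar_solution \<alpha> ?a ?b (f (vertex_point v) v) (f (vertex_point w) w) \<eta>"
  proof (rule complex_eqI)
    show "Re (?U (cis \<eta>)) = Re (polar_solution \<alpha> ?a ?b (f (vertex_point v) v) (f (vertex_point w) w) \<eta>)"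
      unfolding Re_polar_solution
      by (subst part[of Re]) (use harm cont bdry in \<open>auto intro!: continuous_intros\<close>)
    show "Im (?U (cis \<eta>)) = Im (polar_solution \<alpha> ?a ?b (f (vertex_point v) v) (f (vertex_point w) w) \<eta>)"
      unfolding Im_polar_solution
      by (subst part[of Im]) (use harm cont bdry in \<open>auto intro!: continuous_intros\<close>)
  qed
  then show ?thesis using t \<eta> by (simp add: homog)
qed

section \<open>Uniqueness and the balance equations\<close>

lemma graph_cone_eq_Union:
  assumes G: "finite_connected_graph V E" and "E \<noteq> {}"
  shows "graph_cone V E = (\<Union>e\<in>E. cone_over (std_simplex e))"
proof
  show "graph_cone V E \<subseteq> (\<Union>e\<in>E. cone_over (std_simplex e))"
  proof
    fix p assume "p \<in> graph_cone V E"
    then consider e where "e \<in> E" "p \<in> cone_over (std_simplex e)"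
      | v where "v \<in> V" "p \<in> cone_over (std_simplex {v})"
      unfolding graph_cone_def cone_over_def realization_def by blast
    then show "p \<in> (\<Union>e\<in>E. cone_over (std_simplex e))"
    proof cases
      case 2
      obtain w where "{v, w} \<in> E" by (rule vertex_has_neighbour[OF assms 2(1)])
      moreover have "p \<in> cone_over (std_simplex {v, w})"
        using 2(2) by (simp add: cone_over_std_simplex)
      ultimately show ?thesis by blast
    qed blast
  qed
qed (use cone_over_edge_subset in blast)

lemma edge_cases:
  assumes "finite_connected_graph V E" "e \<in> E"
  obtains v w where "e = {v, w}" "v \<noteq> w"
  using assms unfolding finite_connected_graph_def by (metis card_2_iff)

lemma polar_solution_deriv_0:
  assumes "sin (\<alpha> * a) \<noteq> 0"
  shows "((\<lambda>\<eta>. Re (polar_solution \<alpha> a b A B \<eta>)) has_real_derivative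
    \<alpha> * (B * cos b - A * cos (\<alpha> * a)) / sin (\<alpha> * a)) (at 0 within S)"
  unfolding Re_polar_solution
  using assms by (auto intro!: derivative_eq_intros simp: field_simps)

context
  fixes V :: "'v set" and E \<alpha> \<theta> \<phi>
  assumes G: "finite_connected_graph V E" and E: "E \<noteq> {}"
    and \<theta>: "\<And>e. e \<in> E \<Longrightarrow> 0 < \<theta> e \<and> \<theta> e < pi" and \<phi>: "\<And>e. e \<in> E \<Longrightarrow> 0 < \<phi> e \<and> \<phi> e < pi"
    and \<alpha>: "0 < \<alpha>" "\<And>e. e \<in> E \<Longrightarrow> \<alpha> * \<theta> e < pi"
begin

text \<open>The faces cover the cone, and on each face the coordinate representation is an explicit
  function of the two vertex values. The target chart recovers the map from it.\<close>

lemma homogeneous_harmonic_map_unique: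
  assumes f: "homogeneous_harmonic_map V E \<theta> \<phi> \<alpha> f" and g: "homogeneous_harmonic_map V E \<theta> \<phi> \<alpha> g"
    and eq: "\<And>v. v \<in> V \<Longrightarrow> f (vertex_point v) v = g (vertex_point v) v"
    and p: "p \<in> graph_cone V E"
  shows "f p = g p"
proof -
  obtain e where e: "e \<in> E" "p \<in> cone_over (std_simplex e)"
    using p unfolding graph_cone_eq_Union[OF G E] by blast
  obtain v w where vw: "e = {v, w}" "v \<noteq> w" by (rule edge_cases[OF G e(1)])
  note e = e[unfolded vw(1)] and th = \<theta>[OF e(1)[unfolded vw(1)]] and ph = \<phi>[OF e(1)[unfolded vw(1)]]
  have "p \<in> face_chart (\<theta> {v, w}) v w ` sector (\<theta> {v, w})"
    using homeomorphism_image1[OF homeomorphism_face_chart[of "\<theta> {v, w}" v w]] e(2) th vw(2) by simp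
  then obtain t \<eta> where z: "p = face_chart (\<theta> {v, w}) v w (rcis t \<eta>)" "0 \<le> t" "0 \<le> \<eta>" "\<eta> \<le> \<theta> {v, w}"
    unfolding sector_def by blast
  have vV: "v \<in> V" "w \<in> V" using edge_vertices[OF G e(1)] by auto
  have "coord_rep \<theta> \<phi> f v w (rcis t \<eta>) = coord_rep \<theta> \<phi> g v w (rcis t \<eta>)"
    using coord_rep_formula[OF G e(1) f, of t \<eta>] coord_rep_formula[OF G e(1) g, of t \<eta>]
      th ph \<alpha>(2)[OF e(1)] z eq vV by simp
  moreover have "h p = face_chart (\<phi> {v, w}) v w (coord_rep \<theta> \<phi> h v w (rcis t \<eta>))"
    if "homogeneous_harmonic_map V E \<theta> \<phi> \<alpha> h" for h
    unfolding z(1)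
    by (rule face_chart_coord_rep[where \<theta>=\<theta> and \<phi>=\<phi>, OF G e(1), symmetric])
       (use that th ph z rcis_in_sector[of t \<eta>] in \<open>auto simp: homogeneous_harmonic_map_def\<close>)
  ultimately show ?thesis using f g by metis
qed

text \<open>The angular derivative at radius r is \<open>r powr \<alpha>\<close> times its value at
  radius 1. This positive factor does not affect the vanishing of the sum, so one equation per
  vertex remains.\<close>

lemma balanced_map_iff:
  assumes f: "homogeneous_harmonic_map V E \<theta> \<phi> \<alpha> f"
  shows "balanced_map V E \<theta> \<phi> f \<longleftrightarrow> (\<forall>v\<in>V. (\<Sum>w | {v, w} \<in> E.
    \<alpha> * (f (vertex_point w) w * cos (\<phi> {v, w}) - f (vertex_point v) v * cos (\<alpha> * \<theta> {v, w}))
      / sin (\<alpha> * \<theta> {v, w})) = 0)"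
proof -
  define d where "d = (\<lambda>v w. 
    \<alpha> * (f (vertex_point w) w * cos (\<phi> {v, w}) - f (vertex_point v) v * cos (\<alpha> * \<theta> {v, w}))
      / sin (\<alpha> * \<theta> {v, w}))"
  have deriv: "((\<lambda>\<eta>. Re (coord_rep \<theta> \<phi> f v w (rcis r \<eta>))) has_real_derivative r powr \<alpha> * d v w)
      (at 0 within {0..\<theta> {v, w}})" if e: "{v, w} \<in> E" and r: "0 < r" for v w r
  proof -
    let ?g = "\<lambda>\<eta>. r powr \<alpha> * Re (polar_solution \<alpha> (\<theta> {v, w}) (\<phi> {v, w}) (f (vertex_point v) v)
        (f (vertex_point w) w) \<eta>)"
    have "0 < \<alpha> * \<theta> {v, w}" using \<theta>[OF e] \<alpha>(1) by simp
    then have "sin (\<alpha> * \<theta> {v, w}) \<noteq> 0"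
      using sin_gt_zero[of "\<alpha> * \<theta> {v, w}"] \<alpha>(2)[OF e] by simp
    then have "(?g has_real_derivative r powr \<alpha> * d v w) (at 0 within {0..\<theta> {v, w}})"
      unfolding d_def by (intro DERIV_cmult polar_solution_deriv_0)
    moreover have "Re (coord_rep \<theta> \<phi> f v w (rcis r \<eta>)) = ?g \<eta>" if "\<eta> \<in> {0..\<theta> {v, w}}" for \<eta>
      using coord_rep_formula[OF G e f, of r \<eta>] \<theta>[OF e] \<phi>[OF e] \<alpha>(2)[OF e] that r by simp
    ultimately show ?thesis
      unfolding has_field_derivative_def
      using has_derivative_transform[of 0 "{0..\<theta> {v, w}}" "\<lambda>\<eta>. Re (coord_rep \<theta> \<phi> f v w (rcis r \<eta>))" ?g]
        \<theta>[OF e] by simp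
  qed
  \<comment> \<open>0 is a limit point of the interval, so the one-sided derivative is unique and
    the witness in \<open>balanced_map\<close> is forced.\<close>
  have uniq: "D = r powr \<alpha> * d v w" if e: "{v, w} \<in> E" and r: "0 < r"
    and D: "((\<lambda>\<eta>. Re (coord_rep \<theta> \<phi> f v w (rcis r \<eta>))) has_real_derivative D) (at 0 within {0..\<theta> {v, w}})"
    for v w r D
  proof (rule vector_derivative_unique_within)
    show "at 0 within {0..\<theta> {v, w}} \<noteq> bot"
      using \<theta>[OF e] by (simp add: trivial_limit_within islimpt_Icc)
  qed (use D deriv[OF e r] in \<open>simp_all add: has_real_derivative_iff_has_vector_derivative\<close>)
  have "balanced_map V E \<theta> \<phi> f \<longleftrightarrow> (\<forall>v\<in>V. (\<Sum>w | {v, w} \<in> E. d v w) = 0)"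
  proof
    assume bal: "balanced_map V E \<theta> \<phi> f"
    show "\<forall>v\<in>V. (\<Sum>w | {v, w} \<in> E. d v w) = 0"
    proof
      fix v assume "v \<in> V"
      from bal[unfolded balanced_map_def, rule_format, OF this zero_less_one]
      obtain D where D: "\<forall>w. {v, w} \<in> E \<longrightarrow> ((\<lambda>\<eta>. Re (coord_rep \<theta> \<phi> f v w (rcis 1 \<eta>)))
          has_real_derivative D w) (at 0 within {0..\<theta> {v, w}})" "(\<Sum>w | {v, w} \<in> E. D w) = 0"
        by (elim exE conjE)
      have "D w = d v w" if "{v, w} \<in> E" for w using uniq[OF that, of 1 "D w"] D(1) that by simp
      then show "(\<Sum>w | {v, w} \<in> E. d v w) = 0" using D(2) by simp
    qed
  next
    assume sum: "\<forall>v\<in>V. (\<Sum>w | {v, w} \<in> E. d v w) = 0"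
    show "balanced_map V E \<theta> \<phi> f"
      unfolding balanced_map_def
    proof (intro ballI allI impI)
      fix v and r :: real assume "v \<in> V" "0 < r"
      show "\<exists>D. (\<forall>w. {v, w} \<in> E \<longrightarrow> ((\<lambda>\<eta>. Re (coord_rep \<theta> \<phi> f v w (rcis r \<eta>))) has_real_derivative D w)
          (at 0 within {0..\<theta> {v, w}})) \<and> (\<Sum>w | {v, w} \<in> E. D w) = 0"
        using deriv \<open>0 < r\<close> sum \<open>v \<in> V\<close>
        by (intro exI[of _ "\<lambda>w. r powr \<alpha> * d v w"]) (simp flip: sum_distrib_left)
    qed
  qed
  then show ?thesis unfolding d_def .
qed

end

section \<open>Harmonic functions on the graph\<close>

text \<open>Both sides run over all ordered pairs of adjacent vertices, and adjacency is
  symmetric.\<close>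

lemma sum_neighbours_swap:
  fixes g :: "'v \<Rightarrow> 'v \<Rightarrow> real"
  assumes G: "finite_connected_graph V E"
  shows "(\<Sum>v\<in>V. \<Sum>w | {v, w} \<in> E. g v w) = (\<Sum>v\<in>V. \<Sum>w | {v, w} \<in> E. g w v)"
proof -
  have fV: "finite V" using G unfolding finite_connected_graph_def by blast
  have nb: "{w. {v, w} \<in> E} = {w \<in> V. {v, w} \<in> E}" for v using edge_vertices[OF G] by auto
  show ?thesis
    unfolding nb using sum.swap_restrict[OF fV fV, of g "\<lambda>v w. {v, w} \<in> E"]
    by (simp add: insert_commute)
qed

lemma connected_graph_induct:
  assumes "finite_connected_graph V E" "u \<in> V" "v \<in> V" "P u"
    and "\<And>x y. {x, y} \<in> E \<Longrightarrow> P x \<Longrightarrow> P y"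
  shows "P v"
proof -
  have "(u, v) \<in> {(a, b). {a, b} \<in> E}\<^sup>*" using assms unfolding finite_connected_graph_def by blast
  then show ?thesis by (induction rule: rtrancl_induct) (use assms in auto)
qed

lemma finite_neighbours: "finite_connected_graph V E \<Longrightarrow> finite {w. {v, w} \<in> E}"
  by (rule finite_subset[of _ V]) (auto dest: edge_vertices simp: finite_connected_graph_def)

text \<open>Maximum principle: at a vertex where the maximum is attained, the nonnegative
  differences to the neighbours sum to 0, so all neighbours attain it too. Connectedness spreads
  this to every vertex.\<close>

lemma graph_harmonic_imp_constant:
  fixes \<rho> :: "'v \<Rightarrow> real"
  assumes G: "finite_connected_graph V E"
    and harm: "\<And>v. v \<in> V \<Longrightarrow> (\<Sum>w | {v, w} \<in> E. \<rho> w - \<rho> v) = 0"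
  shows "\<exists>c. \<forall>v\<in>V. \<rho> v = c"
proof (cases "V = {}")
  case False
  have fV: "finite V" using G unfolding finite_connected_graph_def by blast
  let ?M = "Max (\<rho> ` V)"
  have le: "\<rho> v \<le> ?M" if "v \<in> V" for v using that fV by simp
  have "?M \<in> \<rho> ` V" using fV False by (intro Max_in) auto
  then obtain u where u: "u \<in> V" "\<rho> u = ?M" by force
  have step: "\<rho> y = ?M" if xy: "{x, y} \<in> E" and x: "\<rho> x = ?M" for x y
  proof -
    have xV: "x \<in> V" using edge_vertices[OF G xy] by blast
    have "(\<Sum>w | {x, w} \<in> E. \<rho> x - \<rho> w) = - (\<Sum>w | {x, w} \<in> E. \<rho> w - \<rho> x)"
      by (simp flip: sum_negf)
    then have "(\<Sum>w | {x, w} \<in> E. \<rho> x - \<rho> w) = 0" using harm[OF xV] by simp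
    moreover have "0 \<le> \<rho> x - \<rho> w" if "{x, w} \<in> E" for w
      using le[of w] x edge_vertices[OF G that] by simp
    ultimately show ?thesis
      using x xy finite_neighbours[OF G] by (subst (asm) sum_nonneg_eq_0_iff) auto
  qed
  have "\<rho> v = ?M" if "v \<in> V" for v
    by (rule connected_graph_induct[where P = "\<lambda>x. \<rho> x = ?M", OF G u(1) that u(2) step])
  then show ?thesis by blast
qed simp

text \<open>Summing over all vertices gives (c - d) times the sum of deg(v) \<rho>(v), which is
  positive because \<rho> is nonnegative and nonzero somewhere and every vertex has a
  neighbour.\<close>

lemma balance_coefficients_eq:
  fixes \<rho> :: "'v \<Rightarrow> real"
  assumes G: "finite_connected_graph V E" and bal: "\<And>v. v \<in> V \<Longrightarrow> (\<Sum>w | {v, w} \<in> E. c * \<rho> w - d * \<rho> v) = 0"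
    and E: "E \<noteq> {}" and \<rho>: "\<And>v. v \<in> V \<Longrightarrow> 0 \<le> \<rho> v" and u: "u \<in> V" "\<rho> u \<noteq> 0"
  shows "c = d"
proof -
  have fV: "finite V" using G unfolding finite_connected_graph_def by blast
  have nn: "0 \<le> (\<Sum>w | {v, w} \<in> E. \<rho> v)" if "v \<in> V" for v using \<rho>[OF that] by (intro sum_nonneg) auto
  obtain x where x: "{u, x} \<in> E" by (rule vertex_has_neighbour[OF G E u(1)])
  have "0 < \<rho> u" using \<rho>[OF u(1)] u(2) by simp
  then have "0 < (\<Sum>w | {u, w} \<in> E. \<rho> u)"
    using x finite_neighbours[OF G] by (intro sum_pos) auto
  then have pos: "0 < (\<Sum>v\<in>V. \<Sum>w | {v, w} \<in> E. \<rho> v)"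
    by (rule sum_pos2[OF fV u(1) _ nn])
  have "0 = (\<Sum>v\<in>V. \<Sum>w | {v, w} \<in> E. c * \<rho> w - d * \<rho> v)" using bal by simp
  also have "\<dots> = c * (\<Sum>v\<in>V. \<Sum>w | {v, w} \<in> E. \<rho> w) - d * (\<Sum>v\<in>V. \<Sum>w | {v, w} \<in> E. \<rho> v)"
    by (simp only: sum_subtractf sum_distrib_left)
  also have "(\<Sum>v\<in>V. \<Sum>w | {v, w} \<in> E. \<rho> w) = (\<Sum>v\<in>V. \<Sum>w | {v, w} \<in> E. \<rho> v)"
    by (rule sum_neighbours_swap[OF G])
  finally show "c = d" using pos by (simp flip: left_diff_distrib)
qed

section \<open>Existence of harmonic extensions\<close>

text \<open>The function is the real part of a holomorphic F. Its gradient is the conjugate of F',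
  its Hessian sends h to the conjugate of F'' h, and the contributions of 1 and \<open>\<i>\<close>
  to the trace cancel.\<close>

lemma harmonic_fun_on_Re_powr:
  fixes \<alpha> :: real and k :: complex
  assumes S: "open S" "S \<inter> \<real>\<^sub>\<le>\<^sub>0 = {}"
    and u: "\<And>z::complex. z \<in> S \<Longrightarrow> u z = Re (k * z powr \<alpha>)"
  shows "harmonic_fun_on u S"
proof -
  define c where "c = complex_of_real \<alpha>"
  define F' where "F' = (\<lambda>z. k * (c * z powr (c - 1)))"
  define F'' where "F'' = (\<lambda>z. k * (c * ((c - 1) * z powr (c - 1 - 1))))"
  have slit: "z \<notin> \<real>\<^sub>\<le>\<^sub>0" if "z \<in> S" for z using S(2) that by blast
  have d1: "((\<lambda>z. k * z powr \<alpha>) has_field_derivative F' z) (at z)"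
    and d2: "(F' has_field_derivative F'' z) (at z)" if "z \<in> S" for z
    unfolding F'_def F''_def c_def
    by (intro DERIV_cmult has_field_derivative_powr slit that)+
  have D: "(u has_derivative (\<lambda>h. cnj (F' z) \<bullet> h)) (at z)" if z: "z \<in> S" for z
  proof (rule has_derivative_transform_within_open[OF _ S(1) z u[symmetric]])
    have "((\<lambda>z. Re (k * z powr \<alpha>)) has_derivative (\<lambda>h. Re (F' z * h))) (at z)"
      using d1[OF z] unfolding has_field_derivative_def by (rule has_derivative_Re)
    then show "((\<lambda>z. Re (k * z powr \<alpha>)) has_derivative (\<lambda>h. cnj (F' z) \<bullet> h)) (at z)"
      by (simp add: inner_complex_def)
  qed
  have H: "((\<lambda>z. cnj (F' z)) has_derivative (\<lambda>h. cnj (F'' z * h))) (at z)" if z: "z \<in> S" for z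
    using d2[OF z] unfolding has_field_derivative_def by (rule has_derivative_cnj)
  have C: "continuous_on S (\<lambda>z. cnj (F'' z * h))" for h
    unfolding F''_def
    by (intro continuous_intros continuous_at_imp_continuous_on ballI
        DERIV_isCont[OF has_field_derivative_powr] slit)
  have T: "(\<Sum>b\<in>Basis. cnj (F'' z * b) \<bullet> b) = 0" for z
    by (simp add: Basis_complex_def inner_complex_def)
  show ?thesis
    unfolding harmonic_fun_on_def
    by (intro exI[of _ "\<lambda>z. cnj (F' z)"] exI[of _ "\<lambda>z h. cnj (F'' z * h)"] conjI ballI allI D H C T)
qed

lemma powr_of_real_polar:
  fixes \<alpha> :: real and z :: complex
  assumes "z \<noteq> 0"
  shows "z powr \<alpha> = rcis (cmod z powr \<alpha>) (\<alpha> * Arg z)"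
proof -
  have "z powr \<alpha> = exp (\<alpha> * Ln z)" using assms by (simp add: powr_def)
  also have "Ln z = ln (cmod z) + \<i> * Arg z" using assms by (simp add: complex_eq_iff Arg_eq_Im_Ln)
  also have "exp (\<alpha> * (ln (cmod z) + \<i> * Arg z)) = exp (of_real (\<alpha> * ln (cmod z))) * exp (\<i> * of_real (\<alpha> * Arg z))"
    by (simp add: algebra_simps flip: exp_add)
  also have "\<dots> = rcis (cmod z powr \<alpha>) (\<alpha> * Arg z)"
    using assms unfolding rcis_def cis_conv_exp exp_of_real by (simp add: powr_def)
  finally show ?thesis .
qed

lemma interior_sector_slit:
  assumes "0 < a" "a < pi"
  shows "interior (sector a) \<inter> \<real>\<^sub>\<le>\<^sub>0 = {}"
proof -
  have False if z: "z \<in> interior (sector a)" "z \<in> \<real>\<^sub>\<le>\<^sub>0" for z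
  proof -
    have "z \<noteq> 0" using zero_notin_interior_sector[OF assms] z by auto
    then have "Arg z = pi" using z by (auto simp: Arg_eq_pi complex_nonpos_Reals_iff complex_eq_iff)
    moreover have "z \<in> sector a" using z interior_subset by blast
    ultimately show False using sector_props[OF assms] assms by force
  qed
  then show ?thesis by blast
qed

text \<open>The angular factor is the real part of (c - i d) cis(\<alpha> \<eta>), so
  \<open>u\<close> is the real part of a constant times the principal branch of z^\<alpha>.\<close>

lemma harmonic_fun_on_sector:
  assumes a: "0 < a" "a < pi"
    and u: "\<And>t \<eta>. 0 \<le> t \<Longrightarrow> 0 \<le> \<eta> \<Longrightarrow> \<eta> \<le> a \<Longrightarrow>
      u (rcis t \<eta>) = t powr \<alpha> * (c * cos (\<alpha> * \<eta>) + d * sin (\<alpha> * \<eta>))"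
  shows "harmonic_fun_on u (interior (sector a))"
proof (rule harmonic_fun_on_Re_powr[OF open_interior interior_sector_slit[OF a]])
  fix z assume z: "z \<in> interior (sector a)"
  then have s: "z \<in> sector a" using interior_subset by blast
  have "z \<noteq> 0" using zero_notin_interior_sector[OF a] z by auto
  moreover have "u (rcis (cmod z) (Arg z)) = cmod z powr \<alpha> * (c * cos (\<alpha> * Arg z) + d * sin (\<alpha> * Arg z))"
    using sector_props[OF a s] by (intro u) auto
  ultimately show "u z = Re (Complex c (- d) * z powr \<alpha>)"
    by (simp add: powr_of_real_polar rcis_cmod_Arg algebra_simps)
qed

section \<open>Barycentric coordinates of points of a sector\<close>

text \<open>The barycentric coordinate, at the endpoint on the positive real axis, of the point
  \<open>A + B * cis b\<close> of a sector of angle \<open>b\<close>. Swapping \<open>A\<close> and \<open>B\<close> reflects the sector and hence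
  gives the other coordinate (lemma \<open>edge_weight_polar\<close>).\<close>

definition edge_weight :: "real \<Rightarrow> real \<Rightarrow> real \<Rightarrow> real" where
  "edge_weight b A B = (let z = complex_of_real A + rcis B b in cmod z * (1 - Arg z / b))"

text \<open>The sector is a convex cone spanned by its two boundary rays. For B > 0 the imaginary
  part is positive, which bounds the argument by 0 and pi; comparison with the second ray bounds it
  by \<open>b\<close>.\<close>

lemma wedge_polar:
  assumes b: "0 < b" "b < pi" and AB: "0 \<le> A" "0 \<le> B"
  obtains r \<eta> where "0 \<le> r" "0 \<le> \<eta>" "\<eta> \<le> b" "complex_of_real A + rcis B b = rcis r \<eta>"
proof (cases "B = 0")
  case True
  then show ?thesis using that[of A 0] AB b by simp
next
  case False
  let ?z = "complex_of_real A + rcis B b"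
  have "0 < sin b" using b by (rule sin_gt_zero)
  then have im: "0 < Im ?z" using False AB by simp
  have pol: "?z = rcis (cmod ?z) (Arg ?z)" by (simp add: rcis_cmod_Arg)
  have arg: "0 < Arg ?z" "Arg ?z < pi" using im Arg_lt_pi by blast+
  \<comment> \<open>The reflection z -> \<open>cis b * cnj z\<close> swaps the two boundary rays.
    The image has imaginary part A sin b >= 0, which excludes arguments above
    \<open>b\<close>.\<close>
  have "cis b * cnj ?z = rcis (cmod ?z) (b - Arg ?z)"
    by (subst pol) (simp add: rcis_def cis_cnj cis_mult mult.left_commute del: rcis_cmod_Arg)
  then have "Im (cis b * cnj ?z) = cmod ?z * sin (b - Arg ?z)" by simp
  moreover have "Im (cis b * cnj ?z) = A * sin b" by (simp add: algebra_simps)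
  ultimately have s: "0 \<le> cmod ?z * sin (b - Arg ?z)" using AB \<open>0 < sin b\<close> by simp
  have "Arg ?z \<le> b"
  proof (rule ccontr)
    assume "\<not> Arg ?z \<le> b"
    then have "0 < sin (Arg ?z - b)" using arg b by (intro sin_gt_zero) auto
    moreover have "0 < cmod ?z" using im by (metis zero_less_norm_iff less_irrefl zero_complex.simps(2))
    ultimately have "0 < cmod ?z * sin (Arg ?z - b)" by (intro mult_pos_pos)
    moreover have "sin (b - Arg ?z) = - sin (Arg ?z - b)" by (simp add: sin_diff)
    ultimately show False using s by (metis mult_minus_right neg_0_le_iff_le not_le)
  qed
  then show ?thesis using that[of "cmod ?z" "Arg ?z"] arg pol by simp
qed

lemma edge_weight_polar:
  assumes b: "0 < b" "b < pi" and r: "0 \<le> r" and \<eta>: "0 \<le> \<eta>" "\<eta> \<le> b"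
    and z: "complex_of_real A + rcis B b = rcis r \<eta>"
  shows "edge_weight b A B = r * (1 - \<eta> / b)" and "edge_weight b B A = r * (\<eta> / b)"
proof -
  have *: "cmod (rcis r x) * (1 - Arg (rcis r x) / b) = r * (1 - x / b)" if "0 \<le> x" "x \<le> b" for x
  proof (cases "r = 0")
    case False
    then have "Arg (rcis r x) = x" using r b that by (intro Arg_rcis) auto
    then show ?thesis using r by simp
  qed simp
  show "edge_weight b A B = r * (1 - \<eta> / b)" unfolding edge_weight_def Let_def z using *[OF \<eta>] .
  \<comment> \<open>The same reflection exchanges A with B and the angle \<eta> with b -
    \<eta>.\<close>
  have "complex_of_real B + rcis A b = cis b * cnj (complex_of_real A + rcis B b)"
    by (simp add: rcis_def cis_cnj algebra_simps cis_mult)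
  also have "\<dots> = rcis r (b - \<eta>)"
    unfolding z by (simp add: rcis_def cis_cnj cis_mult mult.left_commute)
  finally have "edge_weight b B A = r * (1 - (b - \<eta>) / b)"
    unfolding edge_weight_def Let_def using *[of "b - \<eta>"] \<eta> by simp
  then show "edge_weight b B A = r * (\<eta> / b)" using b by (simp add: field_simps)
qed

lemma edge_weight_0_left:
  assumes "0 < b" "b < pi" "0 \<le> B"
  shows "edge_weight b 0 B = 0"
  using edge_weight_polar(1)[of b B b 0 B] assms by simp

lemma edge_weight_0_right:
  assumes "0 < b" "b < pi" "0 \<le> A"
  shows "edge_weight b A 0 = A"
  using edge_weight_polar(1)[of b A 0 A 0] assms by simp

lemma edge_weight_scale:
  assumes "0 \<le> c"
  shows "edge_weight b (c * A) (c * B) = c * edge_weight b A B"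
proof (cases "c = 0")
  case False
  have "complex_of_real (c * A) + rcis (c * B) b = of_real c * (complex_of_real A + rcis B b)"
    by (simp add: rcis_def algebra_simps)
  then show ?thesis using False assms unfolding edge_weight_def Let_def
    by (simp add: norm_mult)
qed (simp add: edge_weight_def)

text \<open>In this form the image point is visibly symmetric under exchanging (v, A) with (w, B),
  which allows a definition on the whole cone without orienting the edges.\<close>

lemma face_chart_wedge:
  assumes b: "0 < b" "b < pi" and AB: "0 \<le> A" "0 \<le> B" and "v \<noteq> w"
  shows "face_chart b v w (complex_of_real A + rcis B b) =
    (\<lambda>u. if u = v then edge_weight b A B else if u = w then edge_weight b B A else 0)"
proof -
  obtain r \<eta> where r: "0 \<le> r" "0 \<le> \<eta>" "\<eta> \<le> b" and z: "complex_of_real A + rcis B b = rcis r \<eta>"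
    by (rule wedge_polar[OF b AB])
  show ?thesis
    unfolding z face_chart_rcis[OF b r(2,3,1)] edge_weight_polar[OF b r z]
    using \<open>v \<noteq> w\<close> by (auto simp: cone_point_def edge_point_def vertex_point_def)
qed

lemma wedge_in_sector:
  assumes b: "0 < b" "b < pi" and AB: "0 \<le> A" "0 \<le> B"
  shows "complex_of_real A + rcis B b \<in> sector b"
proof -
  obtain r \<eta> where "0 \<le> r" "0 \<le> \<eta>" "\<eta> \<le> b" "complex_of_real A + rcis B b = rcis r \<eta>"
    by (rule wedge_polar[OF assms])
  then show ?thesis using rcis_in_sector by simp
qed

section \<open>Amplitudes at the vertices and the extension formula\<close>

text \<open>On a face, \<open>sum p V\<close> is the radius t and \<open>p u / sum p V\<close> is
  the barycentric coordinate of \<open>u\<close>. The amplitude is thus the coefficient at the ray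
  of \<open>u\<close> in t^\<alpha> times the polar solution.\<close>

definition vertex_amplitude ::
  "'v set \<Rightarrow> real \<Rightarrow> real \<Rightarrow> ('v \<Rightarrow> real) \<Rightarrow> ('v \<Rightarrow> real) \<Rightarrow> 'v \<Rightarrow> real" where
  "vertex_amplitude V \<alpha> a \<rho> p u = sum p V powr \<alpha> * sin (\<alpha> * a * (p u / sum p V)) * (\<rho> u / sin (\<alpha> * a))"

text \<open>On a face only the amplitudes of its two vertices are nonzero; summing over all other vertices
  gives a formula that does not refer to the face.\<close>

definition harmonic_extension ::
  "'v set \<Rightarrow> 'v set set \<Rightarrow> real \<Rightarrow> real \<Rightarrow> real \<Rightarrow> ('v \<Rightarrow> real) \<Rightarrow> ('v \<Rightarrow> real) \<Rightarrow> 'v \<Rightarrow> real" where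
  "harmonic_extension V E \<alpha> a b \<rho> = (\<lambda>p\<in>graph_cone V E. \<lambda>u.
     edge_weight b (vertex_amplitude V \<alpha> a \<rho> p u) (\<Sum>x\<in>V - {u}. vertex_amplitude V \<alpha> a \<rho> p x))"

lemma vertex_amplitude_eq_0: "p u = 0 \<Longrightarrow> vertex_amplitude V \<alpha> a \<rho> p u = 0"
  by (simp add: vertex_amplitude_def)

lemma vertex_amplitude_nonneg:
  assumes "finite V" "\<And>x. 0 \<le> p x" "u \<in> V" "0 \<le> \<rho> u" and a: "0 < \<alpha> * a" "\<alpha> * a < pi"
  shows "0 \<le> vertex_amplitude V \<alpha> a \<rho> p u"
proof -
  have "p u \<le> sum p V" using assms by (intro member_le_sum) auto
  moreover have "0 \<le> sum p V" using assms(2) by (simp add: sum_nonneg)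
  ultimately have x: "0 \<le> p u / sum p V" "p u / sum p V \<le> 1"
    using assms(2) by (auto simp: divide_le_eq_1)
  have "\<alpha> * a * (p u / sum p V) \<le> \<alpha> * a" using x a(1) by (intro mult_left_le) auto
  moreover have "0 \<le> \<alpha> * a * (p u / sum p V)" by (rule mult_nonneg_nonneg[OF less_imp_le[OF a(1)] x(1)])
  ultimately have "0 \<le> sin (\<alpha> * a * (p u / sum p V))"
    using a(2) by (intro sin_ge_zero) linarith+
  moreover have "0 < sin (\<alpha> * a)" by (rule sin_gt_zero[OF a])
  ultimately show ?thesis using assms unfolding vertex_amplitude_def by simp
qed

text \<open>The quotient is continuous only where \<open>sum p V\<close> is nonzero. Elsewhere the
  sine stays bounded while the power factor tends to 0.\<close>

lemma continuous_on_vertex_amplitude: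
  fixes V :: "'v set" and S :: "('v \<Rightarrow> real) set"
  assumes "finite V" "0 < \<alpha>" "u \<in> V" and S: "\<And>p x. p \<in> S \<Longrightarrow> 0 \<le> p x"
  shows "continuous_on S (\<lambda>p. vertex_amplitude V \<alpha> a \<rho> p u)"
proof -
  have co: "continuous_on S (\<lambda>p. p x)" for x :: 'v
    by (rule continuous_on_subset[OF continuous_on_product_coordinates subset_UNIV])
  have T: "continuous_on S (\<lambda>p. sum p V)" by (intro continuous_on_sum co)
  have nn: "0 \<le> sum p V" if "p \<in> S" for p using S[OF that] by (simp add: sum_nonneg)
  have P: "continuous_on S (\<lambda>p. sum p V powr \<alpha>)"
    using nn assms by (intro continuous_on_powr' T continuous_on_const) auto
  have "continuous_on S (\<lambda>p. sum p V powr \<alpha> * sin (\<alpha> * a * (p u / sum p V)))"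
    unfolding continuous_on_def
  proof
    fix p assume p: "p \<in> S"
    have P': "((\<lambda>p. sum p V powr \<alpha>) \<longlongrightarrow> sum p V powr \<alpha>) (at p within S)"
      using P p by (simp add: continuous_on_def)
    show "((\<lambda>p. sum p V powr \<alpha> * sin (\<alpha> * a * (p u / sum p V))) \<longlongrightarrow>
        sum p V powr \<alpha> * sin (\<alpha> * a * (p u / sum p V))) (at p within S)"
    proof (cases "sum p V = 0")
      case True
      have "((\<lambda>p. sum p V powr \<alpha> * sin (\<alpha> * a * (p u / sum p V))) \<longlongrightarrow> 0) (at p within S)"
      proof (rule Lim_null_comparison)
        show "((\<lambda>p. sum p V powr \<alpha>) \<longlongrightarrow> 0) (at p within S)" using P' True by simp
        show "\<forall>\<^sub>F q in at p within S. norm (sum q V powr \<alpha> * sin (\<alpha> * a * (q u / sum q V))) \<le> sum q V powr \<alpha>"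
          by (intro always_eventually allI) (simp add: abs_mult mult_left_le)
      qed
      then show ?thesis using True by simp
    next
      case False
      moreover have "((\<lambda>p. p u) \<longlongrightarrow> p u) (at p within S)" "((\<lambda>p. sum p V) \<longlongrightarrow> sum p V) (at p within S)"
        using co[of u] T p by (simp_all add: continuous_on_def)
      ultimately have "((\<lambda>p. p u / sum p V) \<longlongrightarrow> p u / sum p V) (at p within S)"
        by (intro tendsto_divide)
      then show ?thesis
        by (intro tendsto_mult[OF P'] isCont_tendsto_compose[OF isCont_sin] tendsto_mult_left)
    qed
  qed
  then show ?thesis
    unfolding vertex_amplitude_def by (rule continuous_on_mult_right)
qed

lemma vertex_amplitude_cone_point:
  assumes "finite_connected_graph V E" "x \<in> realization V E" "0 \<le> t"
  shows "vertex_amplitude V \<alpha> a \<rho> (cone_point x t) u = t powr \<alpha> * vertex_amplitude V \<alpha> a \<rho> (cone_point x 1) u"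
proof -
  have "sum (cone_point x t) V = t" for t
    using realization_sum[OF assms(1,2)] by (simp add: cone_point_def flip: sum_distrib_left)
  then show ?thesis by (cases "t = 0") (simp_all add: vertex_amplitude_def, simp add: cone_point_def mult.assoc)
qed

section \<open>The harmonic extension of vertex values for constant angles\<close>

context
  fixes V :: "'v set" and E and \<alpha> a b :: real and \<rho> :: "'v \<Rightarrow> real"
  assumes G: "finite_connected_graph V E" and E: "E \<noteq> {}"
    and a: "0 < a" "a < pi" and b: "0 < b" "b < pi" and \<alpha>: "0 < \<alpha>" "\<alpha> * a < pi"
    and \<rho>: "\<And>v. v \<in> V \<Longrightarrow> 0 \<le> \<rho> v"
begin

text \<open>Amplitudes away from the face vanish. So the sum over the other vertices is, at each
  endpoint, the amplitude of the opposite endpoint, as \<open>face_chart_wedge\<close>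
  requires.\<close>

lemma harmonic_extension_face:
  assumes vw: "{v, w} \<in> E" and p: "p \<in> cone_over (std_simplex {v, w})"
  shows "harmonic_extension V E \<alpha> a b \<rho> p = face_chart b v w
    (complex_of_real (vertex_amplitude V \<alpha> a \<rho> p v) + rcis (vertex_amplitude V \<alpha> a \<rho> p w) b)"
    and "0 \<le> vertex_amplitude V \<alpha> a \<rho> p v" and "0 \<le> vertex_amplitude V \<alpha> a \<rho> p w"
    and "sum p V = p v + p w"
proof -
  let ?c = "vertex_amplitude V \<alpha> a \<rho> p"
  have fV: "finite V" using G unfolding finite_connected_graph_def by blast
  have ne: "v \<noteq> w" and V: "v \<in> V" "w \<in> V" using edge_neq[OF G vw] edge_vertices[OF G vw] by auto
  have pC: "p \<in> graph_cone V E" using cone_over_edge_subset[OF vw] p by blast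
  have nn: "\<And>u. 0 \<le> p u" and off: "\<And>u. u \<notin> {v, w} \<Longrightarrow> p u = 0"
    using p by (auto simp: cone_over_std_simplex)
  have c0: "?c u = 0" if "u \<notin> {v, w}" for u using off[OF that] by (rule vertex_amplitude_eq_0)
  show cv: "0 \<le> ?c v" and cw: "0 \<le> ?c w"
    using fV nn V \<rho> a \<alpha> by (auto intro!: vertex_amplitude_nonneg)
  have sub: "sum g V = sum g {v, w}" if "\<And>u. u \<notin> {v, w} \<Longrightarrow> g u = 0" for g :: "'v \<Rightarrow> real"
    using fV V that by (intro sum.mono_neutral_right) auto
  show "sum p V = p v + p w" using sub[of p] off ne by simp
  \<comment> \<open>For \<open>u\<close> outside the face the sum keeps both amplitudes, but then
    \<open>u\<close> itself has amplitude 0 and \<open>edge_weight_0_left\<close> gives weight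
    0.\<close>
  have S: "sum ?c (V - {u}) = ?c v + ?c w - ?c u" for u
  proof (cases "u \<in> V")
    case True
    then show ?thesis using sum_diff1[OF fV, of ?c u] sub[of ?c] c0 ne by simp
  next
    case False
    then have "?c u = 0" using V by (intro c0) auto
    then show ?thesis using False sub[of ?c] c0 ne by simp
  qed
  have "harmonic_extension V E \<alpha> a b \<rho> p u = face_chart b v w (complex_of_real (?c v) + rcis (?c w) b) u" for u
  proof -
    have "harmonic_extension V E \<alpha> a b \<rho> p u = edge_weight b (?c u) (?c v + ?c w - ?c u)"
      using pC by (simp add: harmonic_extension_def S)
    then show ?thesis
      using c0[of u] cv cw b ne by (auto simp: face_chart_wedge edge_weight_0_left)
  qed
  then show "harmonic_extension V E \<alpha> a b \<rho> p = face_chart b v w (complex_of_real (?c v) + rcis (?c w) b)"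
    by blast
qed

text \<open>The amplitudes are homogeneous of degree \<alpha> in the cone parameter, and
  \<open>edge_weight\<close> is positively homogeneous of degree 1.\<close>

lemma harmonic_extension_scale:
  assumes x: "x \<in> realization V E" and t: "0 \<le> t"
  shows "harmonic_extension V E \<alpha> a b \<rho> (cone_point x t) =
    (\<lambda>u. t powr \<alpha> * harmonic_extension V E \<alpha> a b \<rho> (cone_point x 1) u)"
proof -
  have "cone_point x s \<in> graph_cone V E" if "0 \<le> s" for s
    using x that unfolding graph_cone_def cone_over_def by blast
  then show ?thesis
    using t by (simp add: harmonic_extension_def vertex_amplitude_cone_point[OF G x t]
        edge_weight_scale flip: sum_distrib_left)
qed

lemma harmonic_extension_edge:
  assumes "e \<in> E" "p \<in> cone_over (std_simplex e)"
  shows "harmonic_extension V E \<alpha> a b \<rho> p \<in> cone_over (std_simplex e)"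
proof -
  obtain v w where vw: "e = {v, w}" "v \<noteq> w" by (rule edge_cases[OF G assms(1)])
  note * = harmonic_extension_face[OF assms[unfolded vw(1)]]
  show ?thesis
    using homeomorphism_image1[OF homeomorphism_face_chart[OF b vw(2)]] wedge_in_sector[OF b *(2,3)]
    unfolding vw(1) *(1) by blast
qed

lemma harmonic_extension_vertex:
  assumes v: "v \<in> V" and p: "p \<in> cone_over (std_simplex {v})"
  shows "harmonic_extension V E \<alpha> a b \<rho> p \<in> cone_over (std_simplex {v})"
    and "harmonic_extension V E \<alpha> a b \<rho> p v = vertex_amplitude V \<alpha> a \<rho> p v"
proof -
  obtain w where vw: "{v, w} \<in> E" by (rule vertex_has_neighbour[OF G E v])
  have ne: "v \<noteq> w" by (rule edge_neq[OF G vw])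
  have pw: "p w = 0" using p ne by (auto simp: cone_over_std_simplex)
  have p': "p \<in> cone_over (std_simplex {v, w})" using p by (simp add: cone_over_std_simplex)
  note * = harmonic_extension_face[OF vw p']
  have "harmonic_extension V E \<alpha> a b \<rho> p = (\<lambda>u. if u = v then vertex_amplitude V \<alpha> a \<rho> p v else 0)"
    unfolding *(1) face_chart_wedge[OF b *(2,3) ne]
    using *(2) b by (auto simp: vertex_amplitude_eq_0[of p w, OF pw] edge_weight_0_left edge_weight_0_right)
  then show "harmonic_extension V E \<alpha> a b \<rho> p \<in> cone_over (std_simplex {v})"
    and "harmonic_extension V E \<alpha> a b \<rho> p v = vertex_amplitude V \<alpha> a \<rho> p v"
    using *(2) by (auto simp: cone_over_std_simplex)
qed

lemma continuous_on_harmonic_extension: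
  "continuous_on (graph_cone V E) (harmonic_extension V E \<alpha> a b \<rho>)"
  unfolding continuous_on_graph_cone_iff[OF G E]
proof
  fix e assume e: "e \<in> E"
  obtain v w where vw: "e = {v, w}" "v \<noteq> w" by (rule edge_cases[OF G e])
  note e = e[unfolded vw(1)]
  let ?C = "cone_over (std_simplex {v, w})"
  let ?z = "\<lambda>p. complex_of_real (vertex_amplitude V \<alpha> a \<rho> p v) + rcis (vertex_amplitude V \<alpha> a \<rho> p w) b"
  have fV: "finite V" using G unfolding finite_connected_graph_def by blast
  have V: "v \<in> V" "w \<in> V" using edge_vertices[OF G e] by auto
  have nn: "0 \<le> p u" if "p \<in> ?C" for p u using that by (auto simp: cone_over_std_simplex)
  have amp: "continuous_on ?C (\<lambda>p. vertex_amplitude V \<alpha> a \<rho> p u)" if "u \<in> V" for u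
    using fV \<alpha>(1) that nn by (intro continuous_on_vertex_amplitude) auto
  have "continuous_on ?C ?z"
    by (intro continuous_intros amp V)
  moreover have "?z ` ?C \<subseteq> sector b"
    using harmonic_extension_face(2,3)[OF e] wedge_in_sector[OF b] by blast
  ultimately have "continuous_on ?C (\<lambda>p. face_chart b v w (?z p))"
    by (rule continuous_on_compose2[OF homeomorphism_cont1[OF homeomorphism_face_chart[OF b vw(2)]]])
  then show "continuous_on (cone_over (std_simplex e)) (harmonic_extension V E \<alpha> a b \<rho>)"
    unfolding vw(1) using harmonic_extension_face(1)[OF e] by (simp cong: continuous_on_cong)
qed

lemma homogeneous_map_harmonic_extension:
  "homogeneous_map V E \<alpha> (harmonic_extension V E \<alpha> a b \<rho>)"
proof -
  let ?f = "harmonic_extension V E \<alpha> a b \<rho>"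
  have img: "?f p \<in> graph_cone V E" if "p \<in> graph_cone V E" for p
    using that harmonic_extension_edge unfolding graph_cone_eq_Union[OF G E] by blast
  \<comment> \<open>The functions y and s of the homogeneous form are chosen by decomposing the
    images of the points at radius 1; scaling then covers all t.\<close>
  have "\<exists>y s. y \<in> realization V E \<and> 0 \<le> s \<and> ?f (cone_point x 1) = cone_point y s"
    if "x \<in> realization V E" for x
  proof -
    have "cone_point x 1 \<in> graph_cone V E"
      using that zero_le_one unfolding graph_cone_def cone_over_def by blast
    from img[OF this] show ?thesis unfolding graph_cone_def cone_over_def by blast
  qed
  then obtain y s where ys: "\<And>x. x \<in> realization V E \<Longrightarrow>
      y x \<in> realization V E \<and> 0 \<le> s x \<and> ?f (cone_point x 1) = cone_point (y x) (s x)"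
    by metis
  have eq: "?f (cone_point x t) = cone_point (y x) (s x * t powr \<alpha>)" if "x \<in> realization V E" "0 \<le> t" for x t
    using ys[OF that(1)] harmonic_extension_scale[OF that] by (simp add: cone_point_def mult_ac)
  show ?thesis
    unfolding homogeneous_map_def
  proof (intro conjI exI[of _ y] exI[of _ s] ballI allI impI)
    show "?f ` cone_over (std_simplex {v}) \<subseteq> cone_over (std_simplex {v})" if "v \<in> V" for v
      using harmonic_extension_vertex(1)[OF that] by blast
    show "?f ` cone_over (std_simplex e) \<subseteq> cone_over (std_simplex e)" if "e \<in> E" for e
      using harmonic_extension_edge[OF that] by blast
  qed (use \<alpha> img ys eq continuous_on_harmonic_extension in auto)
qed

text \<open>At radius t and angle \<eta> the two amplitudes are the coefficients of 1 and
  \<open>cis b\<close> in the scaled polar solution, and the target chart cancels against its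
  inverse.\<close>

lemma coord_rep_harmonic_extension:
  assumes vw: "{v, w} \<in> E" and \<theta>: "\<theta> {v, w} = a" and \<phi>: "\<phi> {v, w} = b"
    and t: "0 \<le> t" and \<eta>: "0 \<le> \<eta>" "\<eta> \<le> a"
  shows "coord_rep \<theta> \<phi> (harmonic_extension V E \<alpha> a b \<rho>) v w (rcis t \<eta>) =
    of_real (t powr \<alpha>) * polar_solution \<alpha> a b (\<rho> v) (\<rho> w) \<eta>"
proof -
  have ne: "v \<noteq> w" by (rule edge_neq[OF G vw])
  let ?p = "cone_point (edge_point v w (\<eta> / a)) t"
  let ?c = "vertex_amplitude V \<alpha> a \<rho> ?p"
  have "edge_point v w (\<eta> / a) \<in> std_simplex {v, w}"
    using \<eta> a by (intro edge_point_in_simplex ne) auto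
  then have p: "?p \<in> cone_over (std_simplex {v, w})" using t unfolding cone_over_def by blast
  note * = harmonic_extension_face[OF vw p]
  have pv: "?p v = t * (1 - \<eta> / a)" "?p w = t * (\<eta> / a)"
    using ne by (auto simp: cone_point_def edge_point_def vertex_point_def)
  have sum: "sum ?p V = t" unfolding *(4) pv by (simp add: algebra_simps)
  have amp: "?c v = t powr \<alpha> * (\<rho> v * sin (\<alpha> * (a - \<eta>)) / sin (\<alpha> * a))"
    "?c w = t powr \<alpha> * (\<rho> w * sin (\<alpha> * \<eta>) / sin (\<alpha> * a))"
  proof -
    \<comment> \<open>Recovering the angle divides by t. At t = 0 the factor
      \<open>t powr \<alpha>\<close> vanishes on both sides.\<close>
    have "\<alpha> * a * (t * (1 - \<eta> / a) / t) = \<alpha> * (a - \<eta>)" "\<alpha> * a * (t * (\<eta> / a) / t) = \<alpha> * \<eta>" if "t \<noteq> 0"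
      using that a by (simp_all add: field_simps)
    then have "t powr \<alpha> * sin (\<alpha> * a * (t * (1 - \<eta> / a) / t)) = t powr \<alpha> * sin (\<alpha> * (a - \<eta>))"
      "t powr \<alpha> * sin (\<alpha> * a * (t * (\<eta> / a) / t)) = t powr \<alpha> * sin (\<alpha> * \<eta>)"
      by (cases "t = 0", simp, metis)+
    then show "?c v = t powr \<alpha> * (\<rho> v * sin (\<alpha> * (a - \<eta>)) / sin (\<alpha> * a))"
      "?c w = t powr \<alpha> * (\<rho> w * sin (\<alpha> * \<eta>) / sin (\<alpha> * a))"
      unfolding vertex_amplitude_def sum pv by (simp_all only:) simp_all
  qed
  let ?z = "complex_of_real (?c v) + rcis (?c w) b"
  note homeo = homeomorphism_face_chart[OF b ne]
  have z: "?z \<in> sector b" by (rule wedge_in_sector[OF b *(2,3)])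
  then have "face_chart b v w ?z \<in> cone_over (std_simplex {v, w})"
    using homeomorphism_image1[OF homeo] by blast
  from inv_into_face_chart[OF b ne this]
  have "inv_into (sector b) (face_chart b v w) (face_chart b v w ?z) = ?z"
    unfolding homeomorphism_apply1[OF homeo z] .
  then have "coord_rep \<theta> \<phi> (harmonic_extension V E \<alpha> a b \<rho>) v w (rcis t \<eta>) = ?z"
    unfolding coord_rep_def \<theta> \<phi> face_chart_rcis[OF a \<eta> t] *(1) .
  also have "\<dots> = of_real (t powr \<alpha>) * polar_solution \<alpha> a b (\<rho> v) (\<rho> w) \<eta>"
    unfolding amp polar_solution_def by (simp add: rcis_def algebra_simps)
  finally show ?thesis .
qed

lemma homogeneous_harmonic_map_harmonic_extension:
  assumes \<theta>: "\<forall>e\<in>E. \<theta> e = a" and \<phi>: "\<forall>e\<in>E. \<phi> e = b"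
  shows "homogeneous_harmonic_map V E \<theta> \<phi> \<alpha> (harmonic_extension V E \<alpha> a b \<rho>)"
  unfolding homogeneous_harmonic_map_def harmonic_map_def
proof (intro conjI allI impI homogeneous_map_harmonic_extension)
  fix v w assume vw: "{v, w} \<in> E"
  have \<theta>': "\<theta> {v, w} = a" and \<phi>': "\<phi> {v, w} = b" using vw \<theta> \<phi> by auto
  have s: "sin (\<alpha> * a) \<noteq> 0" using sin_gt_zero[of "\<alpha> * a"] a \<alpha> by simp
  note U = coord_rep_harmonic_extension[where \<theta>=\<theta> and \<phi>=\<phi>, OF vw \<theta>' \<phi>']
  show "harmonic_fun_on (\<lambda>z. Re (coord_rep \<theta> \<phi> (harmonic_extension V E \<alpha> a b \<rho>) v w z))
      (interior (sector (\<theta> {v, w})))"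
    unfolding \<theta>'
    \<comment> \<open>Expanding sin(\<alpha>(a - \<eta>)) gives these coefficients of cos(\<alpha>
      \<eta>) and sin(\<alpha> \<eta>).\<close>
    by (rule harmonic_fun_on_sector[OF a, where c = "\<rho> v" and \<alpha> = \<alpha>
          and d = "(\<rho> w * cos b - \<rho> v * cos (\<alpha> * a)) / sin (\<alpha> * a)"])
       (use s in \<open>simp add: U Re_polar_solution sin_diff right_diff_distrib field_simps\<close>)
  show "harmonic_fun_on (\<lambda>z. Im (coord_rep \<theta> \<phi> (harmonic_extension V E \<alpha> a b \<rho>) v w z))
      (interior (sector (\<theta> {v, w})))"
    unfolding \<theta>'
    by (rule harmonic_fun_on_sector[OF a, where c = 0 and \<alpha> = \<alpha> and d = "\<rho> w * sin b / sin (\<alpha> * a)"])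
       (simp add: U Im_polar_solution)
qed

lemma harmonic_extension_vertex_point:
  assumes v: "v \<in> V"
  shows "harmonic_extension V E \<alpha> a b \<rho> (vertex_point v) = cone_point (vertex_point v) (\<rho> v)"
proof -
  have fV: "finite V" using G unfolding finite_connected_graph_def by blast
  have s: "sin (\<alpha> * a) \<noteq> 0" using sin_gt_zero[of "\<alpha> * a"] a \<alpha> by simp
  have C: "vertex_point v \<in> cone_over (std_simplex {v})"
    by (subst cone_over_std_simplex) (auto simp: vertex_point_def)
  have "sum (vertex_point v) V = 1" using fV v by (simp add: vertex_point_def)
  then have "harmonic_extension V E \<alpha> a b \<rho> (vertex_point v) v = \<rho> v"
    unfolding harmonic_extension_vertex(2)[OF v C] vertex_amplitude_def
    using s by (simp add: vertex_point_def)
  then show ?thesis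
    using harmonic_extension_vertex(1)[OF v C]
    by (auto simp: cone_over_std_simplex cone_point_def vertex_point_def fun_eq_iff)
qed

text \<open>The extension satisfies the defining description. Any other solution agrees with it on
  the cone by uniqueness, and outside the cone because both are extensional.\<close>

lemma determined_map_eq_harmonic_extension:
  assumes \<theta>: "\<forall>e\<in>E. \<theta> e = a" and \<phi>: "\<forall>e\<in>E. \<phi> e = b"
  shows "determined_map V E \<theta> \<phi> \<alpha> \<rho> = harmonic_extension V E \<alpha> a b \<rho>"
proof -
  let ?f = "harmonic_extension V E \<alpha> a b \<rho>"
  note hh = homogeneous_harmonic_map_harmonic_extension[OF assms]
  have one: "cone_point x 1 = x" for x :: "'v \<Rightarrow> real" by (simp add: cone_point_def)
  have ext: "?f \<in> extensional (graph_cone V E)" by (simp add: harmonic_extension_def)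
  show ?thesis
    unfolding determined_map_def one
  proof (rule the_equality)
    show "?f \<in> extensional (graph_cone V E) \<and> homogeneous_harmonic_map V E \<theta> \<phi> \<alpha> ?f \<and>
        (\<forall>v\<in>V. ?f (vertex_point v) = cone_point (vertex_point v) (\<rho> v))"
      using ext hh harmonic_extension_vertex_point by blast
  next
    fix g assume g: "g \<in> extensional (graph_cone V E) \<and> homogeneous_harmonic_map V E \<theta> \<phi> \<alpha> g \<and>
        (\<forall>v\<in>V. g (vertex_point v) = cone_point (vertex_point v) (\<rho> v))"
    show "g = ?f"
    proof (rule extensionalityI[of _ "graph_cone V E"])
      fix p assume p: "p \<in> graph_cone V E"
      show "g p = ?f p"
        by (rule homogeneous_harmonic_map_unique[where \<theta>=\<theta> and \<phi>=\<phi> and \<alpha>=\<alpha>, OF G E _ _ _ _ _ hh _ p])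
           (use g \<theta> \<phi> a b \<alpha> harmonic_extension_vertex_point in auto)
    qed (use g ext in auto)
  qed
qed

end

section \<open>Balanced maps\<close>

theorem proposition5p1:
  fixes V :: "'v set" and E :: "'v set set"
    and \<theta> \<phi> :: "'v set \<Rightarrow> real" and \<theta>\<^sub>0 \<phi>\<^sub>0 \<alpha> :: real
  assumes graph: "finite_connected_graph V E" and edge: "E \<noteq> {}"
    and \<theta>\<^sub>0: "0 < \<theta>\<^sub>0" "\<theta>\<^sub>0 < pi" and \<phi>\<^sub>0: "0 < \<phi>\<^sub>0" "\<phi>\<^sub>0 < pi"
    and \<theta>: "\<forall>e\<in>E. \<theta> e = \<theta>\<^sub>0" and \<phi>: "\<forall>e\<in>E. \<phi> e = \<phi>\<^sub>0"
    and \<alpha>: "0 < \<alpha>" "\<alpha> < pi / \<theta>\<^sub>0"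
  shows "((\<exists>f. homogeneous_harmonic_map V E \<theta> \<phi> \<alpha> f \<and> balanced_map V E \<theta> \<phi> f \<and>
               \<not> trivial_map V E f) \<longleftrightarrow> \<alpha> * \<theta>\<^sub>0 = \<phi>\<^sub>0) \<and>
         (\<alpha> * \<theta>\<^sub>0 = \<phi>\<^sub>0 \<and> \<phi>\<^sub>0 = pi / 2 \<longrightarrow>
            (\<forall>\<rho>. (\<forall>v\<in>V. 0 \<le> \<rho> v) \<longrightarrow>
               balanced_map V E \<theta> \<phi> (determined_map V E \<theta> \<phi> \<alpha> \<rho>))) \<and>
         (\<alpha> * \<theta>\<^sub>0 = \<phi>\<^sub>0 \<and> \<phi>\<^sub>0 \<noteq> pi / 2 \<longrightarrow>
            (\<forall>\<rho>. (\<forall>v\<in>V. 0 \<le> \<rho> v) \<longrightarrow>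
               (balanced_map V E \<theta> \<phi> (determined_map V E \<theta> \<phi> \<alpha> \<rho>) \<longleftrightarrow>
                (\<exists>c. \<forall>v\<in>V. \<rho> v = c))))"
proof -
  have \<alpha>\<theta>: "0 < \<alpha> * \<theta>\<^sub>0" "\<alpha> * \<theta>\<^sub>0 < pi" using \<alpha> \<theta>\<^sub>0 by (simp_all add: pos_less_divide_eq)
  have s: "0 < sin (\<alpha> * \<theta>\<^sub>0)" by (rule sin_gt_zero[OF \<alpha>\<theta>])
  \<comment> \<open>The balance sum at \<open>v\<close> without its positive factor \<alpha> /
    sin(\<alpha> \<open>\<theta>\<^sub>0\<close>).\<close>
  define B where "B = (\<lambda>\<rho> v. \<Sum>w | {v, w} \<in> E. cos \<phi>\<^sub>0 * \<rho> w - cos (\<alpha> * \<theta>\<^sub>0) * \<rho> v)"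
  have bal: "balanced_map V E \<theta> \<phi> f \<longleftrightarrow> (\<forall>v\<in>V. B (\<lambda>u. f (vertex_point u) u) v = 0)"
    if f: "homogeneous_harmonic_map V E \<theta> \<phi> \<alpha> f" for f
  proof -
    have "(\<Sum>w | {v, w} \<in> E. \<alpha> * (f (vertex_point w) w * cos (\<phi> {v, w}) -
        f (vertex_point v) v * cos (\<alpha> * \<theta> {v, w})) / sin (\<alpha> * \<theta> {v, w}))
      = \<alpha> / sin (\<alpha> * \<theta>\<^sub>0) * B (\<lambda>u. f (vertex_point u) u) v" for v
      unfolding B_def sum_distrib_left using \<theta> \<phi> by (intro sum.cong) (auto simp: mult_ac)
    then show ?thesis
      using balanced_map_iff[where \<theta>=\<theta> and \<phi>=\<phi> and \<alpha>=\<alpha>, OF graph edge _ _ _ _ f] \<theta> \<phi> \<theta>\<^sub>0 \<phi>\<^sub>0 \<alpha> \<alpha>\<theta> s by simp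
  qed
  have det: "homogeneous_harmonic_map V E \<theta> \<phi> \<alpha> (determined_map V E \<theta> \<phi> \<alpha> \<rho>)"
    "\<And>v. v \<in> V \<Longrightarrow> determined_map V E \<theta> \<phi> \<alpha> \<rho> (vertex_point v) v = \<rho> v"
    if \<rho>: "\<forall>v\<in>V. 0 \<le> \<rho> v" for \<rho>
  proof -
    have *: "determined_map V E \<theta> \<phi> \<alpha> \<rho> = harmonic_extension V E \<alpha> \<theta>\<^sub>0 \<phi>\<^sub>0 \<rho>"
      using \<rho> by (intro determined_map_eq_harmonic_extension graph edge \<theta>\<^sub>0 \<phi>\<^sub>0 \<alpha>(1) \<alpha>\<theta>(2) \<theta> \<phi>) auto
    show "homogeneous_harmonic_map V E \<theta> \<phi> \<alpha> (determined_map V E \<theta> \<phi> \<alpha> \<rho>)"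
      unfolding * using \<rho>
      by (intro homogeneous_harmonic_map_harmonic_extension graph edge \<theta>\<^sub>0 \<phi>\<^sub>0 \<alpha>(1) \<alpha>\<theta>(2) \<theta> \<phi>) auto
    show "determined_map V E \<theta> \<phi> \<alpha> \<rho> (vertex_point v) v = \<rho> v" if "v \<in> V" for v
      unfolding * using \<rho> that \<theta>\<^sub>0 \<phi>\<^sub>0 \<alpha>(1) \<alpha>\<theta>(2)
      by (subst harmonic_extension_vertex_point[OF graph edge]) (auto simp: cone_point_def vertex_point_def)
  qed
  \<comment> \<open>A determined map takes the prescribed values only at the vertices in
    \<open>V\<close>; \<open>B\<close> sees no others, as neighbours lie in
    \<open>V\<close>.\<close>
  have B_cong: "B \<rho> v = B \<rho>' v" if "\<And>u. u \<in> V \<Longrightarrow> \<rho> u = \<rho>' u" "v \<in> V" for \<rho> \<rho>' v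
    unfolding B_def using that edge_vertices[OF graph] by (intro sum.cong) auto
  have bal_det: "balanced_map V E \<theta> \<phi> (determined_map V E \<theta> \<phi> \<alpha> \<rho>) \<longleftrightarrow> (\<forall>v\<in>V. B \<rho> v = 0)"
    if \<rho>: "\<forall>v\<in>V. 0 \<le> \<rho> v" for \<rho>
    unfolding bal[OF det(1)[OF \<rho>]]
    by (intro ball_cong refl arg_cong[where f = "\<lambda>x. x = 0"] B_cong det(2)[OF \<rho>])
  have B_eq: "B \<rho> v = cos \<phi>\<^sub>0 * (\<Sum>w | {v, w} \<in> E. \<rho> w - \<rho> v)" if "\<alpha> * \<theta>\<^sub>0 = \<phi>\<^sub>0" for \<rho> v
    unfolding B_def that sum_distrib_left by (simp add: algebra_simps)
  have cos0: "cos \<phi>\<^sub>0 \<noteq> 0" if "\<phi>\<^sub>0 \<noteq> pi / 2"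
    using cos_inj_pi[of \<phi>\<^sub>0 "pi / 2"] that \<phi>\<^sub>0 by auto
  have necessity: "\<alpha> * \<theta>\<^sub>0 = \<phi>\<^sub>0"
    if f: "homogeneous_harmonic_map V E \<theta> \<phi> \<alpha> f" "balanced_map V E \<theta> \<phi> f" "\<not> trivial_map V E f" for f
  proof -
    let ?\<rho> = "\<lambda>u. f (vertex_point u) u"
    have hom: "homogeneous_map V E \<alpha> f" using f(1) by (simp add: homogeneous_harmonic_map_def)
    have nn: "0 \<le> ?\<rho> v" if v: "v \<in> V" for v
    proof -
      obtain w where "{v, w} \<in> E" by (rule vertex_has_neighbour[OF graph edge v])
      then show ?thesis
        using coord_rep_boundary(3)[where \<theta>=\<theta> and \<phi>=\<phi>, OF graph _ hom] \<theta> \<phi> \<theta>\<^sub>0 \<phi>\<^sub>0 by simp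
    qed
    have "\<exists>u\<in>V. ?\<rho> u \<noteq> 0"
    proof (rule ccontr)
      assume "\<not> (\<exists>u\<in>V. ?\<rho> u \<noteq> 0)"
      then have z: "?\<rho> u = 0" if "u \<in> V" for u using that by blast
      \<comment> \<open>The extension of zero data sends the whole cone to the apex, so by
        uniqueness a map vanishing at all vertices would be trivial.\<close>
      let ?h = "harmonic_extension V E \<alpha> \<theta>\<^sub>0 \<phi>\<^sub>0 (\<lambda>_. 0)"
      have h: "homogeneous_harmonic_map V E \<theta> \<phi> \<alpha> ?h" 
        by (intro homogeneous_harmonic_map_harmonic_extension graph edge \<theta>\<^sub>0 \<phi>\<^sub>0 \<alpha>(1) \<alpha>\<theta>(2) \<theta> \<phi>) auto
      have h0: "?h p = apex" if "p \<in> graph_cone V E" for p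
        using that by (simp add: harmonic_extension_def vertex_amplitude_def edge_weight_def apex_def)
      have vg: "vertex_point u \<in> graph_cone V E" if u: "u \<in> V" for u
      proof -
        obtain w where uw: "{u, w} \<in> E" by (rule vertex_has_neighbour[OF graph edge u])
        have "vertex_point u \<in> cone_over (std_simplex {u, w})"
          by (subst cone_over_std_simplex) (auto simp: vertex_point_def)
        then show ?thesis using cone_over_edge_subset[OF uw] by blast
      qed
      have "f p = ?h p" if "p \<in> graph_cone V E" for p
        using that z \<theta> \<phi> \<theta>\<^sub>0 \<phi>\<^sub>0 \<alpha>(1) \<alpha>\<theta>(2) h0[OF vg]
        by (intro homogeneous_harmonic_map_unique[where \<theta>=\<theta> and \<phi>=\<phi> and \<alpha>=\<alpha>, OF graph edge _ _ _ _ f(1) h])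
          (auto simp: apex_def)
      then show False using f(3) h0 unfolding trivial_map_def by simp
    qed
    then obtain u where u: "u \<in> V" "?\<rho> u \<noteq> 0" by blast
    have "(\<Sum>w | {v, w} \<in> E. cos \<phi>\<^sub>0 * ?\<rho> w - cos (\<alpha> * \<theta>\<^sub>0) * ?\<rho> v) = 0" if "v \<in> V" for v
      using f(2) that unfolding bal[OF f(1)] B_def by blast
    then have "cos \<phi>\<^sub>0 = cos (\<alpha> * \<theta>\<^sub>0)"
      by (rule balance_coefficients_eq[where \<rho> = ?\<rho>, OF graph _ edge nn u])
    \<comment> \<open>Both angles lie between 0 and pi, where the cosine is injective.\<close>
    then show ?thesis using cos_inj_pi[of \<phi>\<^sub>0 "\<alpha> * \<theta>\<^sub>0"] \<phi>\<^sub>0 \<alpha>\<theta> by simp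
  qed
  have sufficiency: "\<exists>f. homogeneous_harmonic_map V E \<theta> \<phi> \<alpha> f \<and> balanced_map V E \<theta> \<phi> f \<and> \<not> trivial_map V E f"
    if eq: "\<alpha> * \<theta>\<^sub>0 = \<phi>\<^sub>0"
  proof -
    \<comment> \<open>With constant data every difference between neighbours is 0, so the map is
      balanced; the value 1 keeps it away from the apex.\<close>
    let ?f = "determined_map V E \<theta> \<phi> \<alpha> (\<lambda>_. 1)"
    obtain v w where vw: "{v, w} \<in> E" using edge edge_cases[OF graph] by blast
    have "v \<in> V" using edge_vertices[OF graph vw] by blast
    then have "?f (vertex_point v) v = 1" by (intro det(2)) auto
    moreover have "vertex_point v \<in> cone_over (std_simplex {v, w})"
      by (subst cone_over_std_simplex) (auto simp: vertex_point_def)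
    then have "vertex_point v \<in> graph_cone V E" using cone_over_edge_subset[OF vw] by blast
    ultimately have "\<not> trivial_map V E ?f" unfolding trivial_map_def apex_def by force
    moreover have "balanced_map V E \<theta> \<phi> ?f" by (simp add: bal_det B_eq[OF eq])
    moreover have "homogeneous_harmonic_map V E \<theta> \<phi> \<alpha> ?f" by (intro det(1)) simp
    ultimately show ?thesis by blast
  qed
  have const_iff: "balanced_map V E \<theta> \<phi> (determined_map V E \<theta> \<phi> \<alpha> \<rho>) \<longleftrightarrow> (\<exists>c. \<forall>v\<in>V. \<rho> v = c)"
    if eq: "\<alpha> * \<theta>\<^sub>0 = \<phi>\<^sub>0" and ne: "\<phi>\<^sub>0 \<noteq> pi / 2" and \<rho>: "\<forall>v\<in>V. 0 \<le> \<rho> v" for \<rho>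
    unfolding bal_det[OF \<rho>]
  proof
    assume "\<forall>v\<in>V. B \<rho> v = 0"
    then show "\<exists>c. \<forall>v\<in>V. \<rho> v = c"
      \<comment> \<open>Cancelling cos \<open>\<phi>\<^sub>0\<close> leaves the equation of a
        harmonic function on the graph.\<close>
      using cos0[OF ne] by (intro graph_harmonic_imp_constant[OF graph]) (simp add: B_eq[OF eq])
  next
    assume "\<exists>c. \<forall>v\<in>V. \<rho> v = c"
    then obtain c where c: "\<And>v. v \<in> V \<Longrightarrow> \<rho> v = c" by blast
    have "B \<rho> v = 0" if "v \<in> V" for v
      using B_cong[of \<rho> "\<lambda>_. c" v] c that by (simp add: B_eq[OF eq])
    then show "\<forall>v\<in>V. B \<rho> v = 0" by blast
  qed
  show ?thesis
  proof (intro conjI impI allI)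
    show "(\<exists>f. homogeneous_harmonic_map V E \<theta> \<phi> \<alpha> f \<and> balanced_map V E \<theta> \<phi> f \<and>
        \<not> trivial_map V E f) \<longleftrightarrow> \<alpha> * \<theta>\<^sub>0 = \<phi>\<^sub>0"
      using necessity sufficiency by blast
    show "balanced_map V E \<theta> \<phi> (determined_map V E \<theta> \<phi> \<alpha> \<rho>)"
      if "\<alpha> * \<theta>\<^sub>0 = \<phi>\<^sub>0 \<and> \<phi>\<^sub>0 = pi / 2" "\<forall>v\<in>V. 0 \<le> \<rho> v" for \<rho>
    proof -
      have "cos \<phi>\<^sub>0 = 0" using that(1) cos_pi_half by metis
      then show ?thesis
        unfolding bal_det[OF that(2)] by (simp add: B_eq[OF conjunct1[OF that(1)]])
    qed
  qed (use const_iff in blast)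
qed

end
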